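(* Let $r\ge0$, let $S\subseteq\{0,1,\ldots,r\}$ be a subset containing $r$, and let $A$ be a cofibrant object of $(f\mathcal{C})_S$. Then for every $k$ with $0\le k<r$ and $k\notin S$, the $k$-page differential $d_k$ of the spectral sequence associated to $A$ is $0$.
   Context: Fix a commutative unital ring $R$. $f\mathcal{C}$ is the category of filtered chain complexes: an object is an unbounded, cohomologically graded chain complex $A$ of $R$-modules (differential $d$ of degree $+1$) with subcomplexes $F_pA$, $p\in\mathbb{Z}$, such that $F_pA\subseteq F_{p+1}A\subseteq A$; a morphism is a chain map $f$ with $f(F_pA)\subseteq F_pB$ for all $p$. For $k\ge 0$ put $Z_k^{p,p+n}(A)=F_pA^n\cap d^{-1}F_{p-k}A^{n+1}$, $B_0^{p,p+n}(A)=F_{p-1}A^n$, and for $k\ge1$, $B_k^{p,p+n}(A)=d\,Z_{k-1}^{p+k-1,p+k-1+n-1}(A)+Z_{k-1}^{p-1,p-1+n}(A)$. The $k$-page of the associated spectral sequence is $E_k^{p,p+n}(A)=Z_k^{p,p+n}(A)/B_k^{p,p+n}(A)$, with $k$-page differential $d_k\colon E_k^{p,p+n}(A)\to E_k^{p-k,p-k+n+1}(A)$, $[a]\mapsto[da]$. An $r$-quasi-isomorphism is a morphism inducing an isomorphism on $E_{r+1}$. $R_{(p)}^n$ is the filtered chain complex with a copy of $R$ in degree $n$ and $0$ elsewhere, with $F_q=0$ for $q<p$ and $F_q=R$ for $q\ge p$. Set $\mathcal{Z}_k(p,n)=\bigl(R_{(p)}^n\xrightarrow{1}R_{(p-k)}^{n+1}\bigr)$,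 and for $k\ge 1$, $\mathcal{B}_k(p,n)=\mathcal{Z}_{k-1}(p+k-1,n-1)\oplus\mathcal{Z}_{k-1}(p-1,n)$, with $\varphi_k\colon\mathcal{Z}_k(p,n)\to\mathcal{B}_k(p,n)$ the diagonal $R_{(p)}^n\to R_{(p)}^n\oplus R_{(p-1)}^n$ in degree $n$ and the identity in degree $n+1$. Let $I_r=\{\varphi_{r+1}\colon\mathcal{Z}_{r+1}(p,n)\to\mathcal{B}_{r+1}(p,n)\}_{p,n\in\mathbb{Z}}$, $J_k=\{0\to\mathcal{Z}_k(p,n)\}_{p,n\in\mathbb{Z}}$, $I_S=I_r\cup\bigcup_{s\in S}J_s$, $J_S=\bigcup_{s\in S}J_s$. $(f\mathcal{C})_S$ is the cofibrantly generated model structure on $f\mathcal{C}$ with weak equivalences the $r$-quasi-isomorphisms, generating cofibrations $I_S$ and generating acyclic cofibrations $J_S$. *)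

theory Defs
  imports "HOL-Algebra.Module" "HOL-Algebra.AbelCoset"
begin

section \<open>Modules\<close>

definition lin_maps ::
  "('r, 'm) ring_scheme \<Rightarrow> ('r, 'a) module \<Rightarrow> ('r, 'b) module \<Rightarrow> ('a \<Rightarrow> 'b) set" where
  "lin_maps R M N =
     {f \<in> hom (add_monoid M) (add_monoid N).
        \<forall>r \<in> carrier R. \<forall>x \<in> carrier M. f (r \<odot>\<^bsub>M\<^esub> x) = r \<odot>\<^bsub>N\<^esub> f x}"

text \<open>The record type \<^typ>\<open>('r, 'a) module\<close> extends that of rings; its fields \<^const>\<open>mult\<close>
  and \<^const>\<open>one\<close> play no role for modules and are left unspecified below.\<close>

definition regular_module :: "('r, 'm) ring_scheme \<Rightarrow> ('r, 'r) module" where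
  "regular_module R =
     \<lparr>carrier = carrier R, mult = undefined, one = undefined,
      zero = \<zero>\<^bsub>R\<^esub>, add = add R, smult = mult R\<rparr>"

definition direct_sum_module ::
  "('r, 'a) module \<Rightarrow> ('r, 'b) module \<Rightarrow> ('r, 'a \<times> 'b) module" where
  "direct_sum_module M N =
     \<lparr>carrier = carrier M \<times> carrier N, mult = undefined, one = undefined,
      zero = (\<zero>\<^bsub>M\<^esub>, \<zero>\<^bsub>N\<^esub>),
      add = (\<lambda>(x, y) (x', y'). (x \<oplus>\<^bsub>M\<^esub> x', y \<oplus>\<^bsub>N\<^esub> y')),
      smult = (\<lambda>r (x, y). (r \<odot>\<^bsub>M\<^esub> x, r \<odot>\<^bsub>N\<^esub> y))\<rparr>"

definition quotient_module :: "('r, 'a) module \<Rightarrow> 'a set \<Rightarrow> ('r, 'a set) module" where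
  "quotient_module M N =
     \<lparr>carrier = a_rcosets\<^bsub>M\<^esub> N, mult = undefined, one = undefined,
      zero = N, add = set_add M,
      smult = (\<lambda>r X. \<Union>x\<in>X. N +>\<^bsub>M\<^esub> (r \<odot>\<^bsub>M\<^esub> x))\<rparr>"


section \<open>Filtered chain complexes\<close>

text \<open>In \<open>cmod A n\<close>, \<open>cdiff A n\<close> and \<open>filt A p n\<close>, which stand for
  \<open>A\<^sup>n\<close>, \<open>d : A\<^sup>n \<rightarrow> A\<^sup>n\<^sup>+\<^sup>1\<close> and \<open>F\<^sub>p A\<^sup>n\<close>, the number \<open>n\<close> is the cohomological degree.
  Maps matter only through their values on the carriers.\<close>

record ('r, 'a) filt_complex =
  cmod :: "int \<Rightarrow> ('r, 'a) module"
  cdiff :: "int \<Rightarrow> 'a \<Rightarrow> 'a"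
  filt :: "int \<Rightarrow> int \<Rightarrow> 'a set"

locale filtered_complex =
  cring R for R :: "('r, 'm) ring_scheme" (structure) +
  fixes A :: "('r, 'a) filt_complex"
  assumes cmod_module: "module R (cmod A n)"
    and cdiff_linear: "cdiff A n \<in> lin_maps R (cmod A n) (cmod A (n + 1))"
    and cdiff_cdiff: "x \<in> carrier (cmod A n) \<Longrightarrow>
           cdiff A (n + 1) (cdiff A n x) = \<zero>\<^bsub>cmod A (n + 1 + 1)\<^esub>"
    and filt_submodule: "submodule (filt A p n) R (cmod A n)"
    and filt_cdiff: "x \<in> filt A p n \<Longrightarrow> cdiff A n x \<in> filt A p (n + 1)"
    and filt_mono: "filt A p n \<subseteq> filt A (p + 1) n"

definition filt_hom ::
  "('r, 'm) ring_scheme \<Rightarrow> ('r, 'a) filt_complex \<Rightarrow> ('r, 'b) filt_complex \<Rightarrow>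
     (int \<Rightarrow> 'a \<Rightarrow> 'b) \<Rightarrow> bool" where
  "filt_hom R A B f \<longleftrightarrow>
     (\<forall>n. f n \<in> lin_maps R (cmod A n) (cmod B n)) \<and>
     (\<forall>n. \<forall>x \<in> carrier (cmod A n). f (n + 1) (cdiff A n x) = cdiff B n (f n x)) \<and>
     (\<forall>p n. f n ` filt A p n \<subseteq> filt B p n)"

definition zero_complex :: "('r, unit) filt_complex" where
  "zero_complex =
     \<lparr>cmod = (\<lambda>_. \<lparr>carrier = UNIV, mult = undefined, one = undefined,
                   zero = (), add = (\<lambda>_ _. ()), smult = (\<lambda>_ _. ())\<rparr>),
      cdiff = (\<lambda>_ _. ()), filt = (\<lambda>_ _. UNIV)\<rparr>"

definition initial_map :: "('r, 'a) filt_complex \<Rightarrow> int \<Rightarrow> unit \<Rightarrow> 'a" where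
  "initial_map A n _ = \<zero>\<^bsub>cmod A n\<^esub>"

definition direct_sum_complex ::
  "('r, 'a) filt_complex \<Rightarrow> ('r, 'b) filt_complex \<Rightarrow> ('r, 'a \<times> 'b) filt_complex" where
  "direct_sum_complex A B =
     \<lparr>cmod = (\<lambda>n. direct_sum_module (cmod A n) (cmod B n)),
      cdiff = (\<lambda>n. map_prod (cdiff A n) (cdiff B n)),
      filt = (\<lambda>p n. filt A p n \<times> filt B p n)\<rparr>"


section \<open>The spectral sequence\<close>

text \<open>The index pair \<open>(p, n)\<close> below is the bidegree written \<open>(p, p + n)\<close> in the
  usual notation \<open>Z\<^sub>k\<^sup>p\<^sup>,\<^sup>p\<^sup>+\<^sup>n\<close>: the objects are subquotients of \<open>A\<^sup>n\<close>, and
  \<open>d\<^sub>k\<close> goes from \<open>(p, n)\<close> to \<open>(p - k, n + 1)\<close>.\<close>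

definition ss_Z :: "('r, 'a) filt_complex \<Rightarrow> nat \<Rightarrow> int \<Rightarrow> int \<Rightarrow> 'a set" where
  "ss_Z A k p n = {a \<in> filt A p n. cdiff A n a \<in> filt A (p - int k) (n + 1)}"

fun ss_B :: "('r, 'a) filt_complex \<Rightarrow> nat \<Rightarrow> int \<Rightarrow> int \<Rightarrow> 'a set" where
  "ss_B A 0 p n = filt A (p - 1) n"
| "ss_B A (Suc j) p n =
     cdiff A (n - 1) ` ss_Z A j (p + int j) (n - 1) <+>\<^bsub>cmod A n\<^esub> ss_Z A j (p - 1) n"

definition ss_page :: "('r, 'a) filt_complex \<Rightarrow> nat \<Rightarrow> int \<Rightarrow> int \<Rightarrow> ('r, 'a set) module" where
  "ss_page A k p n =
     quotient_module ((cmod A n)\<lparr>carrier := ss_Z A k p n\<rparr>) (ss_B A k p n)"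

text \<open>The map \<open>[a] \<mapsto> [da]\<close>. The set of all \<open>[da]\<close>, where \<open>a\<close> runs through
  the representatives of a class, is a singleton.\<close>

definition ss_d :: "('r, 'a) filt_complex \<Rightarrow> nat \<Rightarrow> int \<Rightarrow> int \<Rightarrow> 'a set \<Rightarrow> 'a set" where
  "ss_d A k p n X =
     the_elem ((\<lambda>a. ss_B A k (p - int k) (n + 1) +>\<^bsub>cmod A (n + 1)\<^esub> cdiff A n a) ` X)"


section \<open>The generating cofibrations\<close>

definition cycle_complex ::
  "('r, 'm) ring_scheme \<Rightarrow> nat \<Rightarrow> int \<Rightarrow> int \<Rightarrow> ('r, 'r) filt_complex" where
  "cycle_complex R k p n =
     \<lparr>cmod = (\<lambda>m. if m = n \<or> m = n + 1 then regular_module R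
                  else (regular_module R)\<lparr>carrier := {\<zero>\<^bsub>R\<^esub>}\<rparr>),
      cdiff = (\<lambda>m x. if m = n then x else \<zero>\<^bsub>R\<^esub>),
      filt = (\<lambda>q m. if m = n \<and> p \<le> q \<or> m = n + 1 \<and> p - int k \<le> q
                    then carrier R else {\<zero>\<^bsub>R\<^esub>})\<rparr>"

text \<open>The following two definitions are meaningful for \<open>k \<ge> 1\<close> only. In degree \<open>n + 1\<close>
  the complex \<open>boundary_complex R k p n\<close> is \<open>0 \<oplus> R\<close>, which is identified with \<open>R\<close>.\<close>

definition boundary_complex ::
  "('r, 'm) ring_scheme \<Rightarrow> nat \<Rightarrow> int \<Rightarrow> int \<Rightarrow> ('r, 'r \<times> 'r) filt_complex" where
  "boundary_complex R k p n =
     direct_sum_complex (cycle_complex R (k - 1) (p + int k - 1) (n - 1))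
                        (cycle_complex R (k - 1) (p - 1) n)"

definition phi ::
  "('r, 'm) ring_scheme \<Rightarrow> int \<Rightarrow> int \<Rightarrow> 'r \<Rightarrow> 'r \<times> 'r" where
  "phi R n m x =
     (if m = n then (x, x) else if m = n + 1 then (\<zero>\<^bsub>R\<^esub>, x) else (\<zero>\<^bsub>R\<^esub>, \<zero>\<^bsub>R\<^esub>))"


section \<open>Lifting properties and cofibrant objects\<close>

definition has_lifting ::
  "('r, 'm) ring_scheme \<Rightarrow>
     ('r, 'a) filt_complex \<Rightarrow> ('r, 'b) filt_complex \<Rightarrow> (int \<Rightarrow> 'a \<Rightarrow> 'b) \<Rightarrow>
     ('r, 'x) filt_complex \<Rightarrow> ('r, 'y) filt_complex \<Rightarrow> (int \<Rightarrow> 'x \<Rightarrow> 'y) \<Rightarrow> bool" where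
  "has_lifting R A B i X Y f \<longleftrightarrow>
     (\<forall>u v. filt_hom R A X u \<and> filt_hom R B Y v \<and>
        (\<forall>n. \<forall>a \<in> carrier (cmod A n). f n (u n a) = v n (i n a)) \<longrightarrow>
        (\<exists>h. filt_hom R B X h \<and>
           (\<forall>n. \<forall>a \<in> carrier (cmod A n). h n (i n a) = u n a) \<and>
           (\<forall>n. \<forall>b \<in> carrier (cmod B n). f n (h n b) = v n b)))"

text \<open>The right lifting property against the set \<open>I\<^sub>S\<close>, that is, against all
  \<open>\<phi>\<^sub>r\<^sub>+\<^sub>1\<close> (the set \<open>I\<^sub>r\<close>) and all \<open>0 \<rightarrow> \<Z>\<^sub>s(p, n)\<close> with \<open>s \<in> S\<close>. As \<open>I\<^sub>S\<close> is the set of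
  generating cofibrations of the model structure, these \<open>f\<close> are its acyclic fibrations.\<close>

definition acyclic_fibration ::
  "('r, 'm) ring_scheme \<Rightarrow> nat \<Rightarrow> nat set \<Rightarrow>
     ('r, 'x) filt_complex \<Rightarrow> ('r, 'y) filt_complex \<Rightarrow> (int \<Rightarrow> 'x \<Rightarrow> 'y) \<Rightarrow> bool" where
  "acyclic_fibration R r S X Y f \<longleftrightarrow>
     filt_hom R X Y f \<and>
     (\<forall>p n. has_lifting R
        (cycle_complex R (r + 1) p n) (boundary_complex R (r + 1) p n) (phi R n) X Y f) \<and>
     (\<forall>s \<in> S. \<forall>p n. has_lifting R
        zero_complex (cycle_complex R s p n) (initial_map (cycle_complex R s p n)) X Y f)"

text \<open>The type \<open>'u\<close> is the universe from which the underlying sets of the test objects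
  \<open>X\<close> and \<open>Y\<close> are taken.\<close>

definition cofibration ::
  "'u itself \<Rightarrow> ('r, 'm) ring_scheme \<Rightarrow> nat \<Rightarrow> nat set \<Rightarrow>
     ('r, 'a) filt_complex \<Rightarrow> ('r, 'b) filt_complex \<Rightarrow> (int \<Rightarrow> 'a \<Rightarrow> 'b) \<Rightarrow> bool" where
  "cofibration TYPE('u) R r S A B i \<longleftrightarrow>
     filt_hom R A B i \<and>
     (\<forall>(X :: ('r, 'u) filt_complex) (Y :: ('r, 'u) filt_complex) f.
        filtered_complex R X \<and> filtered_complex R Y \<and> acyclic_fibration R r S X Y f \<longrightarrow>
        has_lifting R A B i X Y f)"

text \<open>For \<open>A\<close> with elements in \<open>'a\<close> and \<open>R\<close> with elements in \<open>'r\<close>, the universe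
  \<^typ>\<open>nat \<Rightarrow> 'a \<times> 'r\<close> has room for a copy of \<open>A\<close> and for the cellular approximation
  \<open>X \<rightarrow> A\<close> given by the small object argument: it takes countably many steps, and \<open>X\<close> has
  at most as many elements as the largest of \<open>A\<close>, \<open>R\<close> and the natural numbers. A lift of the
  identity of \<open>A\<close> exhibits \<open>A\<close> as a retract of \<open>X\<close>, so enlarging the universe further
  does not change which \<open>A\<close> are cofibrant. In any case a lifting property against more test
  objects implies this one.\<close>

definition cofibrant ::
  "('r, 'm) ring_scheme \<Rightarrow> nat \<Rightarrow> nat set \<Rightarrow> ('r, 'a) filt_complex \<Rightarrow> bool" where
  "cofibrant R r S A \<longleftrightarrow>
     cofibration TYPE(nat \<Rightarrow> 'a \<times> 'r) R r S zero_complex A (initial_map A)"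

end

theory Submission
  imports Defs
begin

text \<open>Put \<open>Q\<^sub>p = Z\<^sub>k\<^sub>+\<^sub>1\<^sup>p + F\<^sub>p\<^sub>-\<^sub>1\<close>. The differential \<open>d\<^sub>k\<close> vanishes as soon as \<open>Z\<^sub>k\<^sup>p \<subseteq> Q\<^sub>p\<close>. To
  see this inclusion for cofibrant \<open>A\<close>, it is enough to lift the identity of \<open>A\<close> along one
  acyclic fibration. Let \<open>X\<^sup>n = A\<^sup>n \<oplus> A\<^sup>n\<^sup>-\<^sup>1 \<oplus> A\<^sup>n\<close> with \<open>d(x, b, c) = (dx, c, 0)\<close>, and let \<open>F\<^sub>pX\<close> consist of
  the \<open>(x, b, c)\<close> with \<open>x \<in> F\<^sub>p\<close>, \<open>b, c \<in> Q\<^sub>p\<^sub>+\<^sub>k\<close> and \<open>x - c \<in> Q\<^sub>p\<close>. The first projection \<open>X \<rightarrow> A\<close> is an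
  acyclic fibration because \<open>k < r\<close> and \<open>k \<notin> S\<close>. A section has the form \<open>h(a) = (a, g(a), g(da))\<close>.
  If \<open>a \<in> Z\<^sub>k\<^sup>p\<close>, then \<open>h(da) \<in> F\<^sub>p\<^sub>-\<^sub>kX\<close> gives \<open>g(da) \<in> Q\<^sub>p\<close> and \<open>h(a) \<in> F\<^sub>pX\<close> gives
  \<open>a - g(da) \<in> Q\<^sub>p\<close>, so that \<open>a \<in> Q\<^sub>p\<close>.\<close>

section \<open>Filtered complexes and their pages\<close>

lemma lin_mapsI:
  assumes "\<And>x. x \<in> carrier M \<Longrightarrow> f x \<in> carrier N"
    and "\<And>x y. x \<in> carrier M \<Longrightarrow> y \<in> carrier M \<Longrightarrow> f (x \<oplus>\<^bsub>M\<^esub> y) = f x \<oplus>\<^bsub>N\<^esub> f y"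
    and "\<And>c x. c \<in> carrier R \<Longrightarrow> x \<in> carrier M \<Longrightarrow> f (c \<odot>\<^bsub>M\<^esub> x) = c \<odot>\<^bsub>N\<^esub> f x"
  shows "f \<in> lin_maps R M N"
  using assms by (auto simp: lin_maps_def hom_def)

lemma lin_mapsD:
  assumes "f \<in> lin_maps R M N" "x \<in> carrier M"
  shows "f x \<in> carrier N"
    and "y \<in> carrier M \<Longrightarrow> f (x \<oplus>\<^bsub>M\<^esub> y) = f x \<oplus>\<^bsub>N\<^esub> f y"
    and "c \<in> carrier R \<Longrightarrow> f (c \<odot>\<^bsub>M\<^esub> x) = c \<odot>\<^bsub>N\<^esub> f x"
  using assms by (auto simp: lin_maps_def hom_def)

lemma lin_maps_zero:
  assumes "module R M" "module R N" "f \<in> lin_maps R M N"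
  shows "f \<zero>\<^bsub>M\<^esub> = \<zero>\<^bsub>N\<^esub>"
proof -
  interpret M: module R M by fact
  interpret N: module R N by fact
  \<comment> \<open>Zero is written as a scalar multiple so that homogeneity of \<open>f\<close>
    applies. The rules deleted below would collapse this multiple before \<open>f\<close> acts on
    it.\<close>
  have "f \<zero>\<^bsub>M\<^esub> = f (\<zero>\<^bsub>R\<^esub> \<odot>\<^bsub>M\<^esub> \<zero>\<^bsub>M\<^esub>)" by simp
  also have "\<dots> = \<zero>\<^bsub>N\<^esub>"
    using assms(3) by (simp add: lin_mapsD del: M.smult_l_null M.smult_r_null)
  finally show ?thesis .
qed

lemma lin_maps_comp:
  assumes "f \<in> lin_maps R M N" "g \<in> lin_maps R N P"
  shows "g \<circ> f \<in> lin_maps R M P"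
  using assms by (auto intro!: lin_mapsI simp: lin_mapsD)

text \<open>Negation is multiplication by -1, so closure under inverses follows from closure under
  scalars.\<close>

lemma (in module) submodule_of_smult_closed:
  assumes "H \<subseteq> carrier M" "\<zero>\<^bsub>M\<^esub> \<in> H"
    and "\<And>a b. a \<in> H \<Longrightarrow> b \<in> H \<Longrightarrow> a \<oplus>\<^bsub>M\<^esub> b \<in> H"
    and "\<And>a x. a \<in> carrier R \<Longrightarrow> x \<in> H \<Longrightarrow> a \<odot>\<^bsub>M\<^esub> x \<in> H"
  shows "submodule H R M"
proof (rule submoduleI)
  fix a assume a: "a \<in> H"
  then have "\<ominus>\<^bsub>M\<^esub> a = (\<ominus> \<one>) \<odot>\<^bsub>M\<^esub> a"
    using assms(1) by (subst smult_l_minus) auto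
  with a show "\<ominus>\<^bsub>M\<^esub> a \<in> H" using assms(4) by simp
qed (use assms in auto)

lemma (in module) submodule_zero: "submodule H R M \<Longrightarrow> \<zero>\<^bsub>M\<^esub> \<in> H"
  by (metis subgroup.one_closed submodule.axioms(1) monoid.select_convs(2))

lemma direct_sum_module_simps [simp]:
  "carrier (direct_sum_module M N) = carrier M \<times> carrier N"
  "\<zero>\<^bsub>direct_sum_module M N\<^esub> = (\<zero>\<^bsub>M\<^esub>, \<zero>\<^bsub>N\<^esub>)"
  "(x, y) \<oplus>\<^bsub>direct_sum_module M N\<^esub> (x', y') = (x \<oplus>\<^bsub>M\<^esub> x', y \<oplus>\<^bsub>N\<^esub> y')"
  "c \<odot>\<^bsub>direct_sum_module M N\<^esub> (x, y) = (c \<odot>\<^bsub>M\<^esub> x, c \<odot>\<^bsub>N\<^esub> y)"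
  by (simp_all add: direct_sum_module_def)

lemma module_direct_sum:
  assumes "module R M" "module R N"
  shows "module R (direct_sum_module M N)"
proof -
  interpret M: module R M by fact
  interpret N: module R N by fact
  show ?thesis
  proof (rule moduleI)
    show "abelian_group (direct_sum_module M N)"
    proof (rule abelian_groupI)
      fix x assume "x \<in> carrier (direct_sum_module M N)"
      then show "\<exists>y\<in>carrier (direct_sum_module M N).
                   y \<oplus>\<^bsub>direct_sum_module M N\<^esub> x = \<zero>\<^bsub>direct_sum_module M N\<^esub>"
        by (auto intro!: bexI[of _ "(\<ominus>\<^bsub>M\<^esub> fst x, \<ominus>\<^bsub>N\<^esub> snd x)"] simp: M.l_neg N.l_neg)
    qed (auto simp: M.a_ac N.a_ac)
  qed (auto simp: M.is_cring M.smult_l_distr N.smult_l_distr M.smult_r_distr N.smult_r_distr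
      M.smult_assoc1 N.smult_assoc1)
qed

lemma filt_homD:
  assumes "filt_hom R A B f"
  shows "f n \<in> lin_maps R (cmod A n) (cmod B n)"
    and "x \<in> carrier (cmod A n) \<Longrightarrow> f n x \<in> carrier (cmod B n)"
    and "x \<in> carrier (cmod A n) \<Longrightarrow> y \<in> carrier (cmod A n) \<Longrightarrow>
           f n (x \<oplus>\<^bsub>cmod A n\<^esub> y) = f n x \<oplus>\<^bsub>cmod B n\<^esub> f n y"
    and "c \<in> carrier R \<Longrightarrow> x \<in> carrier (cmod A n) \<Longrightarrow>
           f n (c \<odot>\<^bsub>cmod A n\<^esub> x) = c \<odot>\<^bsub>cmod B n\<^esub> f n x"
    and "x \<in> carrier (cmod A n) \<Longrightarrow> f (n + 1) (cdiff A n x) = cdiff B n (f n x)"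
    and "x \<in> filt A p n \<Longrightarrow> f n x \<in> filt B p n"
proof -
  show lin: "f n \<in> lin_maps R (cmod A n) (cmod B n)"
    using assms by (simp add: filt_hom_def)
  show "x \<in> filt A p n \<Longrightarrow> f n x \<in> filt B p n"
    using assms by (simp add: filt_hom_def image_subset_iff)
qed (use assms in \<open>simp_all add: filt_hom_def lin_mapsD[of "f n" R "cmod A n" "cmod B n"]\<close>)

lemma filt_hom_comp:
  assumes "filt_hom R A B f" "filt_hom R B C g"
  shows "filt_hom R A C (\<lambda>n. g n \<circ> f n)"
  using lin_maps_comp[OF assms[THEN filt_homD(1)]] filt_homD(2,5,6)[OF assms(1)]
    filt_homD(5,6)[OF assms(2)]
  by (simp add: filt_hom_def image_subset_iff)

section \<open>The submodules of cycles and boundaries, and the vanishing of a page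
  differential\<close>

context filtered_complex
begin

sublocale cmod: module R "cmod A n" for n
  by (rule cmod_module)

lemma cdiff_simps [simp]:
  assumes "x \<in> carrier (cmod A n)"
  shows "cdiff A n x \<in> carrier (cmod A (n + 1))"
    and "y \<in> carrier (cmod A n) \<Longrightarrow>
           cdiff A n (x \<oplus>\<^bsub>cmod A n\<^esub> y) = cdiff A n x \<oplus>\<^bsub>cmod A (n + 1)\<^esub> cdiff A n y"
    and "c \<in> carrier R \<Longrightarrow> cdiff A n (c \<odot>\<^bsub>cmod A n\<^esub> x) = c \<odot>\<^bsub>cmod A (n + 1)\<^esub> cdiff A n x"
  using assms by (simp_all add: lin_mapsD[OF cdiff_linear])

lemma cdiff_zero [simp]: "cdiff A n \<zero>\<^bsub>cmod A n\<^esub> = \<zero>\<^bsub>cmod A (n + 1)\<^esub>"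
  by (rule lin_maps_zero[OF cmod_module cmod_module cdiff_linear])

lemma filt_carrier [simp]: "x \<in> filt A p n \<Longrightarrow> x \<in> carrier (cmod A n)"
  using cmod.submoduleE(1)[OF filt_submodule] by blast

lemma filt_simps [simp]:
  "\<zero>\<^bsub>cmod A n\<^esub> \<in> filt A p n"
  "x \<in> filt A p n \<Longrightarrow> y \<in> filt A p n \<Longrightarrow> x \<oplus>\<^bsub>cmod A n\<^esub> y \<in> filt A p n"
  "x \<in> filt A p n \<Longrightarrow> \<ominus>\<^bsub>cmod A n\<^esub> x \<in> filt A p n"
  "c \<in> carrier R \<Longrightarrow> x \<in> filt A p n \<Longrightarrow> c \<odot>\<^bsub>cmod A n\<^esub> x \<in> filt A p n"
  using cmod.submodule_zero[OF filt_submodule] cmod.submoduleE[OF filt_submodule] by blast+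

lemma filt_le:
  assumes "p \<le> q" "x \<in> filt A p n"
  shows "x \<in> filt A q n"
  using assms
proof (induction q rule: int_ge_induct)
  case (step i)
  then show ?case using filt_mono by blast
qed

lemma ss_Z_submodule: "submodule (ss_Z A k p n) R (cmod A n)"
  by (rule cmod.submodule_of_smult_closed) (auto simp: ss_Z_def)

lemma ss_Z_carrier: "x \<in> ss_Z A k p n \<Longrightarrow> x \<in> carrier (cmod A n)"
  by (auto simp: ss_Z_def)

lemma ss_Z_le: "j \<le> k \<Longrightarrow> x \<in> ss_Z A k p n \<Longrightarrow> x \<in> ss_Z A j p n"
  by (auto simp: ss_Z_def intro: filt_le[rotated])

text \<open>Because dd = 0, the condition on the differential in \<open>ss_Z\<close> is automatic
  for a boundary, whatever \<open>k\<close> is; only its own filtration degree counts.\<close>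

lemma boundary_in_ss_Z:
  assumes "x \<in> carrier (cmod A n)" "cdiff A n x \<in> filt A p (n + 1)"
  shows "cdiff A n x \<in> ss_Z A k p (n + 1)"
  using assms by (simp add: ss_Z_def cdiff_cdiff)

lemma ss_B_SucI:
  "z \<in> ss_Z A j (p + int j) (n - 1) \<Longrightarrow> w \<in> ss_Z A j (p - 1) n \<Longrightarrow>
     cdiff A (n - 1) z \<oplus>\<^bsub>cmod A n\<^esub> w \<in> ss_B A (Suc j) p n"
  by (auto simp: set_add_def')

lemma ss_B_SucE:
  assumes "a \<in> ss_B A (Suc j) p n"
  obtains z w where "z \<in> ss_Z A j (p + int j) (n - 1)" "w \<in> ss_Z A j (p - 1) n"
    "a = cdiff A (n - 1) z \<oplus>\<^bsub>cmod A n\<^esub> w"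
  using assms by (auto simp: set_add_def')

lemma ss_B_submodule: "submodule (ss_B A k p n) R (cmod A n)"
proof (cases k)
  case 0
  then show ?thesis by (simp add: filt_submodule)
next
  case (Suc j)
  \<comment> \<open>The general rule lands in degree (n - 1) + 1; here it is restated with
    \<open>n\<close>.\<close>
  have car: "cdiff A (n - 1) x \<in> carrier (cmod A n)" if "x \<in> carrier (cmod A (n - 1))" for x
    using cdiff_simps(1)[OF that] by simp
  have "submodule (ss_B A (Suc j) p n) R (cmod A n)"
  proof (rule cmod.submodule_of_smult_closed)
    show "ss_B A (Suc j) p n \<subseteq> carrier (cmod A n)"
      by (auto elim!: ss_B_SucE dest!: ss_Z_carrier simp: car simp del: ss_B.simps)
    show "\<zero>\<^bsub>cmod A n\<^esub> \<in> ss_B A (Suc j) p n"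
      using ss_B_SucI[OF cmod.submodule_zero[OF ss_Z_submodule]
          cmod.submodule_zero[OF ss_Z_submodule], of n j p] cdiff_zero[of "n - 1"]
      by (simp del: ss_B.simps)
  next
    fix a b assume "a \<in> ss_B A (Suc j) p n" "b \<in> ss_B A (Suc j) p n"
    then obtain z w z' w' where z: "z \<in> ss_Z A j (p + int j) (n - 1)" "z' \<in> ss_Z A j (p + int j) (n - 1)"
      and w: "w \<in> ss_Z A j (p - 1) n" "w' \<in> ss_Z A j (p - 1) n"
      and ab: "a = cdiff A (n - 1) z \<oplus>\<^bsub>cmod A n\<^esub> w" "b = cdiff A (n - 1) z' \<oplus>\<^bsub>cmod A n\<^esub> w'"
      by (metis ss_B_SucE)
    note c = z[THEN ss_Z_carrier] w[THEN ss_Z_carrier]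
    have "a \<oplus>\<^bsub>cmod A n\<^esub> b =
        cdiff A (n - 1) (z \<oplus>\<^bsub>cmod A (n - 1)\<^esub> z') \<oplus>\<^bsub>cmod A n\<^esub> (w \<oplus>\<^bsub>cmod A n\<^esub> w')"
      using cdiff_simps(2)[OF c(1,2)] c by (simp add: ab car cmod.a_ac)
    then show "a \<oplus>\<^bsub>cmod A n\<^esub> b \<in> ss_B A (Suc j) p n"
      using ss_B_SucI cmod.submoduleE(5)[OF ss_Z_submodule] z w by presburger
  next
    fix c a assume c: "c \<in> carrier R" and "a \<in> ss_B A (Suc j) p n"
    then obtain z w where z: "z \<in> ss_Z A j (p + int j) (n - 1)" and w: "w \<in> ss_Z A j (p - 1) n"
      and a: "a = cdiff A (n - 1) z \<oplus>\<^bsub>cmod A n\<^esub> w"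
      by (metis ss_B_SucE)
    have "c \<odot>\<^bsub>cmod A n\<^esub> a =
        cdiff A (n - 1) (c \<odot>\<^bsub>cmod A (n - 1)\<^esub> z) \<oplus>\<^bsub>cmod A n\<^esub> (c \<odot>\<^bsub>cmod A n\<^esub> w)"
      using cdiff_simps(3)[OF z[THEN ss_Z_carrier] c] z[THEN ss_Z_carrier] w[THEN ss_Z_carrier] c
      by (simp add: a car cmod.smult_r_distr)
    then show "c \<odot>\<^bsub>cmod A n\<^esub> a \<in> ss_B A (Suc j) p n"
      using ss_B_SucI cmod.submoduleE(4)[OF ss_Z_submodule] z w c by presburger
  qed
  then show ?thesis using Suc by simp
qed

text \<open>For k = j + 1, an element z of Z_j^(p+j) has dz in F_p and ddz = 0, while differentials
  from Z_j^(p-1) land in F_(p-1-j) = F_(p-k). Hence a coset of B_k through an element of Z_k stays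
  inside Z_k.\<close>

lemma ss_B_subset_ss_Z: "ss_B A k p n \<subseteq> ss_Z A k p n"
proof (cases k)
  case 0
  then show ?thesis
    using filt_le[of "p - 1" p] by (auto simp: ss_Z_def intro: filt_cdiff)
next
  case (Suc j)
  have "cdiff A (n - 1) z \<in> ss_Z A k p n" if "z \<in> ss_Z A j (p + int j) (n - 1)" for z
    using boundary_in_ss_Z[OF ss_Z_carrier[OF that], of p k] that by (simp add: ss_Z_def)
  moreover have "w \<in> ss_Z A k p n" if "w \<in> ss_Z A j (p - 1) n" for w
    using that Suc filt_le[of "p - 1" p w n] by (simp add: ss_Z_def algebra_simps)
  ultimately show ?thesis
    using cmod.submoduleE(5)[OF ss_Z_submodule] unfolding Suc
    by (auto elim!: ss_B_SucE simp del: ss_B.simps)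
qed

text \<open>As B_k \<subseteq> Z_k, all representatives b of a class lie in Z_k, so each db lies in
  the target B_k and its coset is B_k itself, the zero of the target page. The set under
  \<open>the_elem\<close> is therefore a singleton.\<close>

lemma ss_d_eq_zero:
  assumes "\<And>a. a \<in> ss_Z A k p n \<Longrightarrow> cdiff A n a \<in> ss_B A k (p - int k) (n + 1)"
    and "x \<in> carrier (ss_page A k p n)"
  shows "ss_d A k p n x = \<zero>\<^bsub>ss_page A k (p - int k) (n + 1)\<^esub>"
proof -
  let ?B = "ss_B A k (p - int k) (n + 1)"
  obtain a where a: "a \<in> ss_Z A k p n"
    and x: "x = (\<Union>b \<in> ss_B A k p n. {b \<oplus>\<^bsub>cmod A n\<^esub> a})"
    using assms(2) by (auto simp: ss_page_def quotient_module_def A_RCOSETS_def' a_r_coset_def')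
  have "?B +>\<^bsub>cmod A (n + 1)\<^esub> cdiff A n b = ?B" if "b \<in> x" for b
  proof -
    have "b \<in> ss_Z A k p n"
      using that a x ss_B_subset_ss_Z cmod.submoduleE(5)[OF ss_Z_submodule] by blast
    then have db: "cdiff A n b \<in> ?B" by (rule assms(1))
    then have "cdiff A n b \<in> carrier (cmod A (n + 1))"
      using cmod.submoduleE(1)[OF ss_B_submodule] by blast
    then show ?thesis
      using cmod.add.coset_join2[OF _ submodule.axioms(1)[OF ss_B_submodule] db]
      by (simp add: a_r_coset_def)
  qed
  \<comment> \<open>An empty class would give \<open>the_elem\<close> an empty set; a class is
    nonempty because B_k contains 0.\<close>
  moreover have "x \<noteq> {}"
    using x cmod.submodule_zero[OF ss_B_submodule] by auto
  ultimately have *: "(\<lambda>b. ?B +>\<^bsub>cmod A (n + 1)\<^esub> cdiff A n b) ` x = {?B}" by auto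
  show ?thesis unfolding ss_d_def * by (simp add: ss_page_def quotient_module_def)
qed

end

section \<open>Lifting against the generating cofibrations\<close>

lemma regular_module_simps [simp]:
  "carrier (regular_module R) = carrier R" "\<zero>\<^bsub>regular_module R\<^esub> = \<zero>\<^bsub>R\<^esub>"
  "add (regular_module R) = add R" "smult (regular_module R) = mult R"
  by (simp_all add: regular_module_def)

lemma cycle_complex_simps:
  "carrier (cmod (cycle_complex R k p n) m) =
     (if m = n \<or> m = n + 1 then carrier R else {\<zero>\<^bsub>R\<^esub>})"
  "\<zero>\<^bsub>cmod (cycle_complex R k p n) m\<^esub> = \<zero>\<^bsub>R\<^esub>"
  "add (cmod (cycle_complex R k p n) m) = add R"
  "smult (cmod (cycle_complex R k p n) m) = mult R"
  "cdiff (cycle_complex R k p n) m x = (if m = n then x else \<zero>\<^bsub>R\<^esub>)"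
  "filt (cycle_complex R k p n) q m =
     (if m = n \<and> p \<le> q \<or> m = n + 1 \<and> p - int k \<le> q then carrier R else {\<zero>\<^bsub>R\<^esub>})"
  by (auto simp: cycle_complex_def)

lemma (in cring) cycle_complex_filtered: "filtered_complex R (cycle_complex R k p n)"
proof -
  have mod: "module R (cmod (cycle_complex R k p n) m)" for m
  proof (rule moduleI)
    show "abelian_group (cmod (cycle_complex R k p n) m)"
    proof (rule abelian_groupI)
      fix x assume "x \<in> carrier (cmod (cycle_complex R k p n) m)"
      then show "\<exists>y\<in>carrier (cmod (cycle_complex R k p n) m).
          y \<oplus>\<^bsub>cmod (cycle_complex R k p n) m\<^esub> x = \<zero>\<^bsub>cmod (cycle_complex R k p n) m\<^esub>"
        by (intro bexI[of _ "\<ominus> x"]) (auto simp: cycle_complex_simps l_neg split: if_splits)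
    qed (auto simp: cycle_complex_simps a_ac split: if_splits)
  qed (auto simp: cycle_complex_simps l_distr r_distr m_assoc is_cring split: if_splits)
  show ?thesis
  proof (intro filtered_complex.intro filtered_complex_axioms.intro mod is_cring)
    show "cdiff (cycle_complex R k p n) m
        \<in> lin_maps R (cmod (cycle_complex R k p n) m) (cmod (cycle_complex R k p n) (m + 1))" for m
      by (rule lin_mapsI) (auto simp: cycle_complex_simps split: if_splits)
    show "submodule (filt (cycle_complex R k p n) q m) R (cmod (cycle_complex R k p n) m)" for q m
      by (rule module.submodule_of_smult_closed[OF mod])
        (auto simp: cycle_complex_simps split: if_splits)
  qed (auto simp: cycle_complex_simps split: if_splits)
qed

text \<open>The map out of a cycle complex that sends the generator 1 in degree \<open>n\<close> to
  \<open>x\<close>. With the lemmas below it shows that \<open>cycle_complex R k p n\<close>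
  represents \<open>ss_Z A k p n\<close>. One formula serves all \<open>k\<close> and
  \<open>p\<close>, as these affect only the filtration.\<close>

definition cycle_map :: "('r, 'a) filt_complex \<Rightarrow> int \<Rightarrow> 'a \<Rightarrow> int \<Rightarrow> 'r \<Rightarrow> 'a" where
  "cycle_map A n x m c =
     (if m = n then c \<odot>\<^bsub>cmod A n\<^esub> x
      else if m = n + 1 then c \<odot>\<^bsub>cmod A (n + 1)\<^esub> cdiff A n x else \<zero>\<^bsub>cmod A m\<^esub>)"

lemma (in filtered_complex) filt_hom_cycle_map:
  assumes "x \<in> ss_Z A k p n"
  shows "filt_hom R (cycle_complex R k p n) A (cycle_map A n x)"
proof -
  have x: "x \<in> filt A p n" "cdiff A n x \<in> filt A (p - int k) (n + 1)" "x \<in> carrier (cmod A n)"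
    using assms by (auto simp: ss_Z_def)
  have "cycle_map A n x m \<in> lin_maps R (cmod (cycle_complex R k p n) m) (cmod A m)" for m
    using x(3) by (intro lin_mapsI)
      (auto simp: cycle_complex_simps cycle_map_def cmod.smult_l_distr cmod.smult_assoc1 split: if_splits)
  moreover have "cycle_map A n x m ` filt (cycle_complex R k p n) q m \<subseteq> filt A q m" for q m
    using x by (auto simp: cycle_complex_simps cycle_map_def split: if_splits intro: filt_le)
  ultimately show ?thesis
    using x(3) by (auto simp: filt_hom_def cycle_complex_simps cycle_map_def cdiff_cdiff split: if_splits)
qed

lemma (in filtered_complex) filt_hom_cycle_one:
  assumes "filt_hom R (cycle_complex R k p n) A u"
  shows "u n \<one> \<in> ss_Z A k p n"
  using filt_homD(6)[OF assms, of \<one> p n] filt_homD(6)[OF assms, of \<one> "p - int k" "n + 1"]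
    filt_homD(5)[OF assms, of \<one> n]
  by (simp add: cycle_complex_simps ss_Z_def)

text \<open>The image of 1 in degree \<open>n\<close> determines the map: in degree \<open>n\<close>
  by linearity, in degree n + 1 because there every element is the differential of one in degree
  \<open>n\<close>, and elsewhere because the source is zero.\<close>

lemma (in filtered_complex) filt_hom_cycle_eq:
  assumes u: "filt_hom R (cycle_complex R k p n) A u"
    and c: "c \<in> carrier (cmod (cycle_complex R k p n) m)"
  shows "u m c = cycle_map A n (u n \<one>) m c"
proof -
  interpret C: filtered_complex R "cycle_complex R k p n" by (rule cycle_complex_filtered)
  have zero: "u m \<zero> = \<zero>\<^bsub>cmod A m\<^esub>"
    using lin_maps_zero[OF C.cmod_module cmod_module filt_homD(1)[OF u], of m]
    by (simp add: cycle_complex_simps)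
  have n: "u n c = c \<odot>\<^bsub>cmod A n\<^esub> u n \<one>" if "c \<in> carrier R"
    using filt_homD(4)[OF u that, of \<one> n] that by (simp add: cycle_complex_simps)
  show ?thesis
  proof (cases "m = n + 1")
    case True
    then have "u m c = cdiff A n (u n c)"
      using filt_homD(5)[OF u, of c n] c by (simp add: cycle_complex_simps)
    then show ?thesis
      using True c n filt_homD(2)[OF u, of \<one> n] by (simp add: cycle_complex_simps cycle_map_def)
  next
    case False
    then show ?thesis
      using c n zero by (auto simp: cycle_complex_simps cycle_map_def split: if_splits)
  qed
qed

lemma cycle_map_natural:
  assumes X: "filtered_complex R X" and Y: "filtered_complex R Y" and f: "filt_hom R X Y f"
    and x: "x \<in> carrier (cmod X n)" and c: "c \<in> carrier R"
  shows "f m (cycle_map X n x m c) = cycle_map Y n (f n x) m c"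
proof -
  interpret X: filtered_complex R X by fact
  interpret Y: filtered_complex R Y by fact
  have "f m \<zero>\<^bsub>cmod X m\<^esub> = \<zero>\<^bsub>cmod Y m\<^esub>"
    by (rule lin_maps_zero[OF X.cmod_module Y.cmod_module filt_homD(1)[OF f]])
  then show ?thesis
    using x c by (auto simp: cycle_map_def filt_homD[OF f])
qed

lemma zero_complex_simps:
  "carrier (cmod zero_complex n) = UNIV" "filt zero_complex p n = UNIV"
  "cdiff zero_complex n x = ()"
  by (auto simp: zero_complex_def)

lemma (in filtered_complex) filt_hom_zero_complex:
  assumes "filt_hom R zero_complex A u"
  shows "u n a = \<zero>\<^bsub>cmod A n\<^esub>"
  using filt_homD(4)[OF assms, of \<zero> "()" n] filt_homD(2)[OF assms, of "()" n]
  by (simp add: zero_complex_simps)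

lemma (in filtered_complex) filt_hom_initial_map:
  "filt_hom R zero_complex A (initial_map A)"
  by (auto simp: filt_hom_def initial_map_def zero_complex_simps intro!: lin_mapsI)

text \<open>By representability, \<open>v\<close> is an element of Z_s(Y) and a lift is a preimage
  of it in Z_s(X). The map \<open>u\<close> out of the zero complex carries no information.\<close>

lemma has_lifting_cycleI:
  assumes X: "filtered_complex R X" and Y: "filtered_complex R Y" and f: "filt_hom R X Y f"
    and surj: "\<And>y. y \<in> ss_Z Y s p n \<Longrightarrow> \<exists>x \<in> ss_Z X s p n. f n x = y"
  shows "has_lifting R zero_complex (cycle_complex R s p n)
           (initial_map (cycle_complex R s p n)) X Y f"
  unfolding has_lifting_def
proof (intro allI impI, elim conjE)
  interpret X: filtered_complex R X by fact
  interpret Y: filtered_complex R Y by fact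
  interpret C: filtered_complex R "cycle_complex R s p n" by (rule X.cycle_complex_filtered)
  fix u v
  assume u: "filt_hom R zero_complex X u" and v: "filt_hom R (cycle_complex R s p n) Y v"
  obtain x where x: "x \<in> ss_Z X s p n" "f n x = v n \<one>\<^bsub>R\<^esub>"
    using surj[OF Y.filt_hom_cycle_one[OF v]] by blast
  let ?h = "cycle_map X n x"
  have h: "filt_hom R (cycle_complex R s p n) X ?h" by (rule X.filt_hom_cycle_map[OF x(1)])
  have "?h m (initial_map (cycle_complex R s p n) m a) = u m a" for m a
    using lin_maps_zero[OF C.cmod_module X.cmod_module filt_homD(1)[OF h]]
    by (simp add: initial_map_def X.filt_hom_zero_complex[OF u])
  moreover have "f m (?h m b) = v m b" if "b \<in> carrier (cmod (cycle_complex R s p n) m)" for m b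
    using cycle_map_natural[OF X Y f X.ss_Z_carrier[OF x(1)], of b m] that x(2)
      Y.filt_hom_cycle_eq[OF v that]
    by (simp add: cycle_complex_simps split: if_splits)
  ultimately show "\<exists>h. filt_hom R (cycle_complex R s p n) X h \<and>
      (\<forall>m. \<forall>a\<in>carrier (cmod zero_complex m).
         h m (initial_map (cycle_complex R s p n) m a) = u m a) \<and>
      (\<forall>m. \<forall>b\<in>carrier (cmod (cycle_complex R s p n) m). f m (h m b) = v m b)"
    using h by blast
qed

section \<open>Direct sums and the lifting property against the maps into boundary complexes\<close>

lemma direct_sum_complex_simps:
  "cmod (direct_sum_complex A B) n = direct_sum_module (cmod A n) (cmod B n)"
  "cdiff (direct_sum_complex A B) n = map_prod (cdiff A n) (cdiff B n)"
  "filt (direct_sum_complex A B) p n = filt A p n \<times> filt B p n"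
  by (simp_all add: direct_sum_complex_def)

lemma
  assumes A: "filtered_complex R A" and B: "filtered_complex R B"
  shows filt_hom_inl: "filt_hom R A (direct_sum_complex A B) (\<lambda>m a. (a, \<zero>\<^bsub>cmod B m\<^esub>))"
    and filt_hom_inr: "filt_hom R B (direct_sum_complex A B) (\<lambda>m b. (\<zero>\<^bsub>cmod A m\<^esub>, b))"
proof -
  interpret A: filtered_complex R A by fact
  interpret B: filtered_complex R B by fact
  show "filt_hom R A (direct_sum_complex A B) (\<lambda>m a. (a, \<zero>\<^bsub>cmod B m\<^esub>))"
    "filt_hom R B (direct_sum_complex A B) (\<lambda>m b. (\<zero>\<^bsub>cmod A m\<^esub>, b))"
    by (auto simp: filt_hom_def direct_sum_complex_simps intro!: lin_mapsI)
qed

lemma filt_hom_copair: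
  assumes A: "filtered_complex R A" and B: "filtered_complex R B" and X: "filtered_complex R X"
    and f: "filt_hom R A X f" and g: "filt_hom R B X g"
  shows "filt_hom R (direct_sum_complex A B) X (\<lambda>m (a, b). f m a \<oplus>\<^bsub>cmod X m\<^esub> g m b)"
proof -
  interpret A: filtered_complex R A by fact
  interpret B: filtered_complex R B by fact
  interpret X: filtered_complex R X by fact
  have "(\<lambda>(a, b). f m a \<oplus>\<^bsub>cmod X m\<^esub> g m b)
      \<in> lin_maps R (cmod (direct_sum_complex A B) m) (cmod X m)" for m
    by (rule lin_mapsI)
      (auto simp: direct_sum_complex_simps filt_homD[OF f] filt_homD[OF g]
        X.cmod.smult_r_distr X.cmod.a_ac)
  then show ?thesis
    by (auto simp: filt_hom_def direct_sum_complex_simps filt_homD[OF f] filt_homD[OF g])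
qed

text \<open>By representability, a square against \<open>phi\<close> consists of x in Z_(r+1)(X) and
  a pair \<open>y\<^sub>1\<close>, \<open>y\<^sub>2\<close> of cycles of Y that exhibits f(x) as an
  element of B_(r+1)(Y). A lift is a pair in X over this one that exhibits x itself as an element of
  B_(r+1)(X).\<close>

lemma has_lifting_boundaryI:
  assumes X: "filtered_complex R X" and Y: "filtered_complex R Y" and f: "filt_hom R X Y f"
    and lift: "\<And>x y\<^sub>1 y\<^sub>2. x \<in> ss_Z X (Suc r) p n \<Longrightarrow> y\<^sub>1 \<in> ss_Z Y r (p + int r) (n - 1) \<Longrightarrow>
        y\<^sub>2 \<in> ss_Z Y r (p - 1) n \<Longrightarrow> f n x = cdiff Y (n - 1) y\<^sub>1 \<oplus>\<^bsub>cmod Y n\<^esub> y\<^sub>2 \<Longrightarrow>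
        \<exists>x\<^sub>1 \<in> ss_Z X r (p + int r) (n - 1). \<exists>x\<^sub>2 \<in> ss_Z X r (p - 1) n.
          f (n - 1) x\<^sub>1 = y\<^sub>1 \<and> f n x\<^sub>2 = y\<^sub>2 \<and> x = cdiff X (n - 1) x\<^sub>1 \<oplus>\<^bsub>cmod X n\<^esub> x\<^sub>2"
  shows "has_lifting R (cycle_complex R (r + 1) p n) (boundary_complex R (r + 1) p n) (phi R n) X Y f"
  unfolding has_lifting_def
proof (intro allI impI, elim conjE)
  interpret X: filtered_complex R X by fact
  interpret Y: filtered_complex R Y by fact
  let ?C\<^sub>1 = "cycle_complex R r (p + int r) (n - 1)" and ?C\<^sub>2 = "cycle_complex R r (p - 1) n"
  let ?C = "cycle_complex R (r + 1) p n" and ?B = "boundary_complex R (r + 1) p n"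
  interpret C\<^sub>1: filtered_complex R ?C\<^sub>1 by (rule X.cycle_complex_filtered)
  interpret C\<^sub>2: filtered_complex R ?C\<^sub>2 by (rule X.cycle_complex_filtered)
  interpret C: filtered_complex R ?C by (rule X.cycle_complex_filtered)
  have B: "?B = direct_sum_complex ?C\<^sub>1 ?C\<^sub>2" by (simp add: boundary_complex_def)
  fix u v
  assume u: "filt_hom R ?C X u" and v: "filt_hom R ?B Y v"
    and comm: "\<forall>m. \<forall>a\<in>carrier (cmod ?C m). f m (u m a) = v m (phi R n m a)"
  have v\<^sub>1: "filt_hom R ?C\<^sub>1 Y (\<lambda>m a. v m (a, \<zero>\<^bsub>R\<^esub>))"
    using filt_hom_comp[OF filt_hom_inl[OF C\<^sub>1.filtered_complex_axioms C\<^sub>2.filtered_complex_axioms] v[unfolded B]]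
    by (simp add: comp_def cycle_complex_simps)
  have v\<^sub>2: "filt_hom R ?C\<^sub>2 Y (\<lambda>m b. v m (\<zero>\<^bsub>R\<^esub>, b))"
    using filt_hom_comp[OF filt_hom_inr[OF C\<^sub>1.filtered_complex_axioms C\<^sub>2.filtered_complex_axioms] v[unfolded B]]
    by (simp add: comp_def cycle_complex_simps)
  define y\<^sub>1 where "y\<^sub>1 = v (n - 1) (\<one>\<^bsub>R\<^esub>, \<zero>\<^bsub>R\<^esub>)"
  define y\<^sub>2 where "y\<^sub>2 = v n (\<zero>\<^bsub>R\<^esub>, \<one>\<^bsub>R\<^esub>)"
  have y: "y\<^sub>1 \<in> ss_Z Y r (p + int r) (n - 1)" "y\<^sub>2 \<in> ss_Z Y r (p - 1) n"
    using Y.filt_hom_cycle_one[OF v\<^sub>1] Y.filt_hom_cycle_one[OF v\<^sub>2] by (simp_all add: y\<^sub>1_def y\<^sub>2_def)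
  \<comment> \<open>Splitting (a, b) = (a, 0) + (0, b) reduces \<open>v\<close> to its restrictions
    to the two summands, each determined by the image of its generator.\<close>
  have v_eq: "v m (a, b) = cycle_map Y (n - 1) y\<^sub>1 m a \<oplus>\<^bsub>cmod Y m\<^esub> cycle_map Y n y\<^sub>2 m b"
    if a: "a \<in> carrier (cmod ?C\<^sub>1 m)" and b: "b \<in> carrier (cmod ?C\<^sub>2 m)" for m a b
  proof -
    have "a \<in> carrier R" "b \<in> carrier R" using a b by (auto simp: cycle_complex_simps split: if_splits)
    then have "v m (a, b) = v m (a, \<zero>\<^bsub>R\<^esub>) \<oplus>\<^bsub>cmod Y m\<^esub> v m (\<zero>\<^bsub>R\<^esub>, b)"
      using filt_homD(3)[OF v[unfolded B], of "(a, \<zero>\<^bsub>R\<^esub>)" m "(\<zero>\<^bsub>R\<^esub>, b)"] a b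
      by (simp add: direct_sum_complex_simps cycle_complex_simps split: if_splits)
    then show ?thesis
      using Y.filt_hom_cycle_eq[OF v\<^sub>1 a] Y.filt_hom_cycle_eq[OF v\<^sub>2 b] by (simp add: y\<^sub>1_def y\<^sub>2_def)
  qed
  let ?x = "u n \<one>\<^bsub>R\<^esub>"
  have x: "?x \<in> ss_Z X (Suc r) p n" using X.filt_hom_cycle_one[OF u] by simp
  have "f n ?x = v n (\<one>\<^bsub>R\<^esub>, \<one>\<^bsub>R\<^esub>)"
    using comm by (simp add: cycle_complex_simps phi_def)
  \<comment> \<open>The summand \<open>?C\<^sub>1\<close> starts in degree n - 1, so its 1 in degree
    \<open>n\<close> is the differential of its generator and goes to the differential of
    \<open>y\<^sub>1\<close>.\<close>
  also have "\<dots> = cdiff Y (n - 1) y\<^sub>1 \<oplus>\<^bsub>cmod Y n\<^esub> y\<^sub>2"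
    using v_eq[of \<open>\<one>\<^bsub>R\<^esub>\<close> n \<open>\<one>\<^bsub>R\<^esub>\<close>] y[THEN Y.ss_Z_carrier] Y.cdiff_simps(1)[of y\<^sub>1 "n - 1"]
    by (simp add: cycle_complex_simps cycle_map_def)
  finally obtain x\<^sub>1 x\<^sub>2 where xs: "x\<^sub>1 \<in> ss_Z X r (p + int r) (n - 1)" "x\<^sub>2 \<in> ss_Z X r (p - 1) n"
    and fx: "f (n - 1) x\<^sub>1 = y\<^sub>1" "f n x\<^sub>2 = y\<^sub>2" and x_eq: "?x = cdiff X (n - 1) x\<^sub>1 \<oplus>\<^bsub>cmod X n\<^esub> x\<^sub>2"
    using lift[OF x y] by blast
  note car = xs[THEN X.ss_Z_carrier] X.cdiff_simps(1)[OF xs(1)[THEN X.ss_Z_carrier], simplified]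
  define h where "h = (\<lambda>m (a, b). cycle_map X (n - 1) x\<^sub>1 m a \<oplus>\<^bsub>cmod X m\<^esub> cycle_map X n x\<^sub>2 m b)"
  note hom = X.filt_hom_cycle_map[OF xs(1)] X.filt_hom_cycle_map[OF xs(2)]
  have "filt_hom R ?B X h"
    unfolding B h_def
    by (rule filt_hom_copair[OF C\<^sub>1.filtered_complex_axioms C\<^sub>2.filtered_complex_axioms X hom])
  moreover have "h m (phi R n m a) = u m a" if a: "a \<in> carrier (cmod ?C m)" for m a
  proof -
    have "a \<in> carrier R" using a by (auto simp: cycle_complex_simps split: if_splits)
    \<comment> \<open>In degree n + 1 \<open>phi\<close> meets only the second summand; the upper
      triangle commutes there because the term from \<open>x\<^sub>1\<close> is killed by dd =
      0.\<close>
    moreover have "cdiff X n ?x = cdiff X n x\<^sub>2"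
      using X.cdiff_cdiff[OF car(1)] car by (simp add: x_eq)
    ultimately show ?thesis
      using car a unfolding X.filt_hom_cycle_eq[OF u a]
      by (auto simp: h_def cycle_map_def phi_def x_eq X.cmod.smult_r_distr)
  qed
  moreover have "f m (h m b) = v m b" if b: "b \<in> carrier (cmod ?B m)" for m b
  proof -
    obtain b\<^sub>1 b\<^sub>2 where b_eq: "b = (b\<^sub>1, b\<^sub>2)" by fastforce
    have b\<^sub>1: "b\<^sub>1 \<in> carrier (cmod ?C\<^sub>1 m)" and b\<^sub>2: "b\<^sub>2 \<in> carrier (cmod ?C\<^sub>2 m)"
      using b unfolding B b_eq by (simp_all add: direct_sum_complex_simps)
    then have "b\<^sub>1 \<in> carrier R" "b\<^sub>2 \<in> carrier R" by (auto simp: cycle_complex_simps split: if_splits)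
    then show ?thesis
      using filt_homD(3)[OF f filt_homD(2)[OF hom(1) b\<^sub>1] filt_homD(2)[OF hom(2) b\<^sub>2]]
        cycle_map_natural[OF X Y f car(1), of b\<^sub>1 m] cycle_map_natural[OF X Y f car(2), of b\<^sub>2 m]
      by (simp add: b_eq h_def v_eq[OF b\<^sub>1 b\<^sub>2] fx)
  qed
  ultimately show "\<exists>h. filt_hom R ?B X h \<and> (\<forall>m. \<forall>a\<in>carrier (cmod ?C m). h m (phi R n m a) = u m a) \<and>
      (\<forall>m. \<forall>b\<in>carrier (cmod ?B m). f m (h m b) = v m b)"
    by blast
qed

section \<open>Change of universe\<close>

definition filt_iso ::
  "('r, 'm) ring_scheme \<Rightarrow> ('r, 'a) filt_complex \<Rightarrow> ('r, 'b) filt_complex \<Rightarrow>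
     (int \<Rightarrow> 'a \<Rightarrow> 'b) \<Rightarrow> (int \<Rightarrow> 'b \<Rightarrow> 'a) \<Rightarrow> bool" where
  "filt_iso R A B f g \<longleftrightarrow> filt_hom R A B f \<and> filt_hom R B A g \<and>
     (\<forall>n. \<forall>x \<in> carrier (cmod A n). g n (f n x) = x) \<and>
     (\<forall>n. \<forall>y \<in> carrier (cmod B n). f n (g n y) = y)"

lemma filt_iso_sym: "filt_iso R A B f g \<Longrightarrow> filt_iso R B A g f"
  by (auto simp: filt_iso_def)

lemma has_liftingE:
  assumes "has_lifting R A B i X Y f" "filt_hom R A X u" "filt_hom R B Y v"
    and "\<And>n a. a \<in> carrier (cmod A n) \<Longrightarrow> f n (u n a) = v n (i n a)"
  obtains h where "filt_hom R B X h"
    "\<And>n a. a \<in> carrier (cmod A n) \<Longrightarrow> h n (i n a) = u n a"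
    "\<And>n b. b \<in> carrier (cmod B n) \<Longrightarrow> f n (h n b) = v n b"
  using assms(1)[unfolded has_lifting_def, rule_format, of u v] assms(2-4) by auto

text \<open>A square for \<open>f'\<close> is carried to one for \<open>f\<close> by the inverses
  \<open>a'\<close> and \<open>b'\<close>, lifted there, and the lift is followed by
  \<open>a\<close>.\<close>

lemma has_lifting_iso:
  assumes lift: "has_lifting R A B i X Y f"
    and X: "filt_iso R X X' a a'" and Y: "filt_iso R Y Y' b b'"
    and f': "filt_hom R X' Y' f'"
    and i: "\<And>n x. x \<in> carrier (cmod A n) \<Longrightarrow> i n x \<in> carrier (cmod B n)"
    and comm: "\<And>n x. x \<in> carrier (cmod X' n) \<Longrightarrow> f n (a' n x) = b' n (f' n x)"
  shows "has_lifting R A B i X' Y' f'"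
  unfolding has_lifting_def
proof (intro allI impI, elim conjE)
  fix u v
  assume u: "filt_hom R A X' u" and v: "filt_hom R B Y' v"
    and uv: "\<forall>n. \<forall>x\<in>carrier (cmod A n). f' n (u n x) = v n (i n x)"
  have a: "filt_hom R X X' a" "filt_hom R X' X a'" using X by (auto simp: filt_iso_def)
  have b': "filt_hom R Y' Y b'" using Y by (auto simp: filt_iso_def)
  have "f n ((a' n \<circ> u n) x) = (b' n \<circ> v n) (i n x)" if "x \<in> carrier (cmod A n)" for n x
    using uv comm filt_homD(2)[OF u that] that by simp
  then obtain h where h: "filt_hom R B X h"
    "\<And>n x. x \<in> carrier (cmod A n) \<Longrightarrow> h n (i n x) = a' n (u n x)"
    "\<And>n x. x \<in> carrier (cmod B n) \<Longrightarrow> f n (h n x) = b' n (v n x)"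
    using has_liftingE[OF lift filt_hom_comp[OF u a(2)] filt_hom_comp[OF v b']]
    unfolding comp_def by blast
  have "(a n \<circ> h n) (i n x) = u n x" if "x \<in> carrier (cmod A n)" for n x
    using X h(2)[OF that] filt_homD(2)[OF u that] by (simp add: filt_iso_def)
  moreover have "f' n ((a n \<circ> h n) x) = v n x" if x: "x \<in> carrier (cmod B n)" for n x
  proof -
    have hx: "h n x \<in> carrier (cmod X n)" by (rule filt_homD(2)[OF h(1) x])
    \<comment> \<open>The equation is checked after applying \<open>b'\<close>, which
      \<open>b\<close> inverts on the carrier.\<close>
    have "b' n (f' n (a n (h n x))) = f n (a' n (a n (h n x)))"
      using comm[OF filt_homD(2)[OF a(1) hx]] by simp
    also have "\<dots> = b' n (v n x)" using X hx h(3)[OF x] by (simp add: filt_iso_def)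
    finally have "b n (b' n (f' n (a n (h n x)))) = b n (b' n (v n x))" by simp
    then show ?thesis
      using Y filt_homD(2)[OF f' filt_homD(2)[OF a(1) hx]] filt_homD(2)[OF v x]
      by (simp add: filt_iso_def)
  qed
  ultimately show "\<exists>h. filt_hom R B X' h \<and> (\<forall>n. \<forall>x\<in>carrier (cmod A n). h n (i n x) = u n x) \<and>
      (\<forall>n. \<forall>x\<in>carrier (cmod B n). f' n (h n x) = v n x)"
    using filt_hom_comp[OF h(1) a(1)] by blast
qed

text \<open>A copy of a module inside another type. The map \<open>e\<close> is meant to be
  injective on its whole type, so that \<open>the_inv e\<close> is a left inverse and
  \<open>e\<close> is an isomorphism onto its image.\<close>

definition transport_module :: "('a \<Rightarrow> 'b) \<Rightarrow> ('r, 'a) module \<Rightarrow> ('r, 'b) module" where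
  "transport_module e M =
     \<lparr>carrier = e ` carrier M, mult = undefined, one = undefined, zero = e \<zero>\<^bsub>M\<^esub>,
      add = (\<lambda>x y. e (the_inv e x \<oplus>\<^bsub>M\<^esub> the_inv e y)),
      smult = (\<lambda>c x. e (c \<odot>\<^bsub>M\<^esub> the_inv e x))\<rparr>"

definition transport_complex :: "('a \<Rightarrow> 'b) \<Rightarrow> ('r, 'a) filt_complex \<Rightarrow> ('r, 'b) filt_complex" where
  "transport_complex e A =
     \<lparr>cmod = (\<lambda>n. transport_module e (cmod A n)),
      cdiff = (\<lambda>n x. e (cdiff A n (the_inv e x))),
      filt = (\<lambda>p n. e ` filt A p n)\<rparr>"

lemma transport_complex_simps:
  "carrier (cmod (transport_complex e A) n) = e ` carrier (cmod A n)"
  "\<zero>\<^bsub>cmod (transport_complex e A) n\<^esub> = e \<zero>\<^bsub>cmod A n\<^esub>"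
  "x \<oplus>\<^bsub>cmod (transport_complex e A) n\<^esub> y = e (the_inv e x \<oplus>\<^bsub>cmod A n\<^esub> the_inv e y)"
  "c \<odot>\<^bsub>cmod (transport_complex e A) n\<^esub> x = e (c \<odot>\<^bsub>cmod A n\<^esub> the_inv e x)"
  "cdiff (transport_complex e A) n x = e (cdiff A n (the_inv e x))"
  "filt (transport_complex e A) p n = e ` filt A p n"
  by (simp_all add: transport_complex_def transport_module_def)

lemma (in filtered_complex) transport_complex_filtered:
  assumes "inj e"
  shows "filtered_complex R (transport_complex e A)"
proof -
  note [simp] = transport_complex_simps the_inv_f_f[OF assms]
  have mod: "module R (cmod (transport_complex e A) n)" for n
  proof (rule moduleI)
    show "abelian_group (cmod (transport_complex e A) n)"
    proof (rule abelian_groupI)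
      fix x assume "x \<in> carrier (cmod (transport_complex e A) n)"
      then show "\<exists>y\<in>carrier (cmod (transport_complex e A) n).
          y \<oplus>\<^bsub>cmod (transport_complex e A) n\<^esub> x = \<zero>\<^bsub>cmod (transport_complex e A) n\<^esub>"
        by (intro bexI[of _ "e (\<ominus>\<^bsub>cmod A n\<^esub> the_inv e x)"]) (auto simp: cmod.l_neg)
    qed (auto simp: cmod.a_ac)
  qed (auto simp: cmod.smult_l_distr cmod.smult_r_distr cmod.smult_assoc1 is_cring)
  show ?thesis
  proof (intro filtered_complex.intro filtered_complex_axioms.intro mod is_cring)
    show "cdiff (transport_complex e A) n
        \<in> lin_maps R (cmod (transport_complex e A) n) (cmod (transport_complex e A) (n + 1))" for n
      by (rule lin_mapsI) auto
    show "submodule (filt (transport_complex e A) p n) R (cmod (transport_complex e A) n)" for p n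
      by (rule module.submodule_of_smult_closed[OF mod]) auto
    show "filt (transport_complex e A) p n \<subseteq> filt (transport_complex e A) (p + 1) n" for p n
      using filt_mono by auto
  qed (auto simp: cdiff_cdiff filt_cdiff)
qed

lemma (in filtered_complex) transport_complex_iso:
  assumes "inj e"
  shows "filt_iso R A (transport_complex e A) (\<lambda>_. e) (\<lambda>_. the_inv e)"
proof -
  note [simp] = transport_complex_simps the_inv_f_f[OF assms]
  have "filt_hom R A (transport_complex e A) (\<lambda>_. e)"
    by (simp add: filt_hom_def lin_mapsI)
  moreover have "filt_hom R (transport_complex e A) A (\<lambda>_. the_inv e)"
    unfolding filt_hom_def by (intro conjI allI ballI lin_mapsI) auto
  ultimately show ?thesis
    by (auto simp: filt_iso_def)
qed

lemma acyclic_fibration_iso: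
  assumes f: "acyclic_fibration R r S X Y f" and R: "cring R"
    and X: "filt_iso R X X' a a'" and Y: "filt_iso R Y Y' b b'"
    and f': "filt_hom R X' Y' f'"
    and comm: "\<And>n x. x \<in> carrier (cmod X' n) \<Longrightarrow> f n (a' n x) = b' n (f' n x)"
  shows "acyclic_fibration R r S X' Y' f'"
proof -
  interpret cring R by fact
  have phi: "phi R n m x \<in> carrier (cmod (boundary_complex R (r + 1) p n) m)"
    if "x \<in> carrier (cmod (cycle_complex R (r + 1) p n) m)" for p n m x
    using that by (auto simp: boundary_complex_def direct_sum_complex_def cycle_complex_def
        direct_sum_module_def regular_module_def phi_def split: if_splits)
  have zero: "initial_map (cycle_complex R s p n) m x \<in> carrier (cmod (cycle_complex R s p n) m)"
    for s p n m x
    by (auto simp: initial_map_def cycle_complex_def regular_module_def)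
  show ?thesis
    unfolding acyclic_fibration_def
  proof (intro conjI allI ballI f')
    fix p n
    show "has_lifting R (cycle_complex R (r + 1) p n) (boundary_complex R (r + 1) p n) (phi R n) X' Y' f'"
      by (rule has_lifting_iso[OF _ X Y f' phi comm])
        (use f in \<open>simp_all add: acyclic_fibration_def\<close>)
    show "has_lifting R zero_complex (cycle_complex R s p n)
        (initial_map (cycle_complex R s p n)) X' Y' f'" if "s \<in> S" for s
      by (rule has_lifting_iso[OF _ X Y f' zero comm])
        (use f that in \<open>simp_all add: acyclic_fibration_def\<close>)
  qed
qed

text \<open>\<open>cofibrant\<close> tests only against complexes with elements in
  \<open>nat \<Rightarrow> 'a \<times> 'r\<close>. A fibration between complexes whose element types
  embed there is transported along the embeddings, lifted against, and the lift is moved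
  back.\<close>

lemma cofibrant_lifting:
  fixes A :: "('r, 'a) filt_complex" and X :: "('r, 'x) filt_complex"
    and Y :: "('r, 'y) filt_complex"
    and e\<^sub>X :: "'x \<Rightarrow> nat \<Rightarrow> 'a \<times> 'r" and e\<^sub>Y :: "'y \<Rightarrow> nat \<Rightarrow> 'a \<times> 'r"
  assumes cof: "cofibrant R r S A" and A: "filtered_complex R A"
    and X: "filtered_complex R X" and Y: "filtered_complex R Y"
    and f: "acyclic_fibration R r S X Y f"
    and inj: "inj e\<^sub>X" "inj e\<^sub>Y"
  shows "has_lifting R zero_complex A (initial_map A) X Y f"
proof -
  interpret A: filtered_complex R A by fact
  interpret X: filtered_complex R X by fact
  interpret Y: filtered_complex R Y by fact
  let ?X = "transport_complex e\<^sub>X X" and ?Y = "transport_complex e\<^sub>Y Y"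
  let ?f = "\<lambda>n. e\<^sub>Y \<circ> (f n \<circ> the_inv e\<^sub>X)"
  note isoX = X.transport_complex_iso[OF inj(1)] and isoY = Y.transport_complex_iso[OF inj(2)]
  have homf: "filt_hom R X Y f" using f by (simp add: acyclic_fibration_def)
  have f': "filt_hom R ?X ?Y ?f"
    using isoX isoY
    by (intro filt_hom_comp[OF filt_hom_comp[OF _ homf], of _ "\<lambda>_. the_inv e\<^sub>X" _ "\<lambda>_. e\<^sub>Y"])
      (simp_all add: filt_iso_def)
  have "acyclic_fibration R r S ?X ?Y ?f"
    by (rule acyclic_fibration_iso[OF f A.is_cring isoX isoY f'])
      (auto simp: the_inv_f_f[OF inj(2)])
  then have *: "has_lifting R zero_complex A (initial_map A) ?X ?Y ?f"
    using cof X.transport_complex_filtered[OF inj(1)] Y.transport_complex_filtered[OF inj(2)]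
    by (simp add: cofibrant_def cofibration_def)
  show ?thesis
    by (rule has_lifting_iso[OF * isoX[THEN filt_iso_sym] isoY[THEN filt_iso_sym] homf])
      (auto simp: initial_map_def the_inv_f_f[OF inj(1)])
qed

section \<open>The test fibration\<close>

text \<open>The Q_p of the overview. An element of Z_k^p that lies in Q_p represents a class killed
  by d_k. Adding all of F_(p-1) makes Q_p increase with p, as a filtration must.\<close>

definition ss_ZF :: "('r, 'a) filt_complex \<Rightarrow> nat \<Rightarrow> int \<Rightarrow> int \<Rightarrow> 'a set" where
  "ss_ZF A k p n = ss_Z A (Suc k) p n <+>\<^bsub>cmod A n\<^esub> filt A (p - 1) n"

lemma ss_ZFI:
  "z \<in> ss_Z A (Suc k) p n \<Longrightarrow> w \<in> filt A (p - 1) n \<Longrightarrow> x = z \<oplus>\<^bsub>cmod A n\<^esub> w \<Longrightarrow>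
     x \<in> ss_ZF A k p n"
  by (auto simp: ss_ZF_def set_add_def')

lemma ss_ZFE:
  assumes "x \<in> ss_ZF A k p n"
  obtains z w where "z \<in> ss_Z A (Suc k) p n" "w \<in> filt A (p - 1) n" "x = z \<oplus>\<^bsub>cmod A n\<^esub> w"
  using assms by (auto simp: ss_ZF_def set_add_def')

context filtered_complex
begin

lemma ss_ZF_submodule: "submodule (ss_ZF A k p n) R (cmod A n)"
proof (rule cmod.submodule_of_smult_closed)
  note Z = cmod.submoduleE(4,5)[OF ss_Z_submodule]
  show "ss_ZF A k p n \<subseteq> carrier (cmod A n)"
    by (auto elim!: ss_ZFE simp: ss_Z_carrier)
  show "\<zero>\<^bsub>cmod A n\<^esub> \<in> ss_ZF A k p n"
    by (rule ss_ZFI[OF cmod.submodule_zero[OF ss_Z_submodule] filt_simps(1)]) simp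
  fix a assume "a \<in> ss_ZF A k p n"
  then obtain z w where z: "z \<in> ss_Z A (Suc k) p n" and w: "w \<in> filt A (p - 1) n"
    and a: "a = z \<oplus>\<^bsub>cmod A n\<^esub> w"
    by (rule ss_ZFE)
  note car = ss_Z_carrier[OF z] filt_carrier[OF w]
  {
    fix b assume "b \<in> ss_ZF A k p n"
    then obtain z' w' where z': "z' \<in> ss_Z A (Suc k) p n" and w': "w' \<in> filt A (p - 1) n"
      and b: "b = z' \<oplus>\<^bsub>cmod A n\<^esub> w'"
      by (rule ss_ZFE)
    have "a \<oplus>\<^bsub>cmod A n\<^esub> b = (z \<oplus>\<^bsub>cmod A n\<^esub> z') \<oplus>\<^bsub>cmod A n\<^esub> (w \<oplus>\<^bsub>cmod A n\<^esub> w')"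
      using car ss_Z_carrier[OF z'] filt_carrier[OF w'] by (simp add: a b cmod.a_ac)
    then show "a \<oplus>\<^bsub>cmod A n\<^esub> b \<in> ss_ZF A k p n"
      by (rule ss_ZFI[OF Z(2)[OF z z'] filt_simps(2)[OF w w']])
  next
    fix c assume c: "c \<in> carrier R"
    have "c \<odot>\<^bsub>cmod A n\<^esub> a = c \<odot>\<^bsub>cmod A n\<^esub> z \<oplus>\<^bsub>cmod A n\<^esub> c \<odot>\<^bsub>cmod A n\<^esub> w"
      using car c by (simp add: a cmod.smult_r_distr)
    then show "c \<odot>\<^bsub>cmod A n\<^esub> a \<in> ss_ZF A k p n"
      by (rule ss_ZFI[OF Z(1)[OF c z] filt_simps(4)[OF c w]])
  }
qed

lemma ss_ZF_simps [simp]: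
  "\<zero>\<^bsub>cmod A n\<^esub> \<in> ss_ZF A k p n"
  "x \<in> ss_ZF A k p n \<Longrightarrow> y \<in> ss_ZF A k p n \<Longrightarrow> x \<oplus>\<^bsub>cmod A n\<^esub> y \<in> ss_ZF A k p n"
  "x \<in> ss_ZF A k p n \<Longrightarrow> \<ominus>\<^bsub>cmod A n\<^esub> x \<in> ss_ZF A k p n"
  "c \<in> carrier R \<Longrightarrow> x \<in> ss_ZF A k p n \<Longrightarrow> c \<odot>\<^bsub>cmod A n\<^esub> x \<in> ss_ZF A k p n"
  by (rule cmod.submodule_zero[OF ss_ZF_submodule] cmod.submoduleE(3-5)[OF ss_ZF_submodule];
      assumption)+

lemma ss_ZF_carrier: "x \<in> ss_ZF A k p n \<Longrightarrow> x \<in> carrier (cmod A n)"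
  using cmod.submoduleE(1)[OF ss_ZF_submodule] by blast

lemma ss_ZF_diff:
  "x \<in> ss_ZF A k p n \<Longrightarrow> y \<in> ss_ZF A k p n \<Longrightarrow> x \<ominus>\<^bsub>cmod A n\<^esub> y \<in> ss_ZF A k p n"
  by (simp add: a_minus_def)

lemma ss_Z_subset_ss_ZF:
  assumes "x \<in> ss_Z A j p n" "k < j"
  shows "x \<in> ss_ZF A k p n"
proof -
  have "x \<in> ss_Z A (Suc k) p n" using assms ss_Z_le[of "Suc k" j] by simp
  moreover have "x = x \<oplus>\<^bsub>cmod A n\<^esub> \<zero>\<^bsub>cmod A n\<^esub>" using assms(1)[THEN ss_Z_carrier] by simp
  ultimately show ?thesis by (rule ss_ZFI[OF _ filt_simps(1)])
qed

lemma boundary_in_ss_ZF: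
  assumes "x \<in> carrier (cmod A n)" "cdiff A n x \<in> filt A p (n + 1)"
  shows "cdiff A n x \<in> ss_ZF A k p (n + 1)"
  using boundary_in_ss_Z[OF assms, of "Suc k"] by (simp add: ss_Z_subset_ss_ZF)

lemma filt_subset_ss_ZF:
  assumes "x \<in> filt A p n" "p < q"
  shows "x \<in> ss_ZF A k q n"
proof -
  have "x \<in> filt A (q - 1) n" using assms by (auto intro: filt_le[rotated])
  moreover have "x = \<zero>\<^bsub>cmod A n\<^esub> \<oplus>\<^bsub>cmod A n\<^esub> x" using assms(1) filt_carrier by simp
  ultimately show ?thesis by (rule ss_ZFI[OF cmod.submodule_zero[OF ss_Z_submodule]])
qed

lemma ss_ZF_subset_filt: "x \<in> ss_ZF A k p n \<Longrightarrow> x \<in> filt A p n"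
  using filt_le[of "p - 1" p _ n] by (auto elim!: ss_ZFE simp: ss_Z_def)

text \<open>This follows from the interleaving F_(p-1) \<subseteq> Q_p \<subseteq> F_p.\<close>

lemma ss_ZF_le: "p \<le> q \<Longrightarrow> x \<in> ss_ZF A k p n \<Longrightarrow> x \<in> ss_ZF A k q n"
  using filt_subset_ss_ZF[OF ss_ZF_subset_filt, of x k p n q k] by (cases "p = q") simp_all

text \<open>Write a = z + w with z in Z_(k+1)^p and w in F_(p-1). For k > 0, dw = da - dz lies in
  F_(p-k), so w is in Z_(k-1)^(p-1), and dz is a boundary in F_(p-k-1), so it is in Z_(k-1)^(p-k-1).
  Thus dw and dz are the two kinds of terms that make up B_k^(p-k). For k = 0 both lie in
  F_(p-1).\<close>

lemma cdiff_in_ss_B: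
  assumes "a \<in> ss_ZF A k p n" "a \<in> ss_Z A k p n"
  shows "cdiff A n a \<in> ss_B A k (p - int k) (n + 1)"
proof -
  obtain z w where z: "z \<in> ss_Z A (Suc k) p n" and w: "w \<in> filt A (p - 1) n"
    and a: "a = z \<oplus>\<^bsub>cmod A n\<^esub> w"
    using assms(1) by (auto simp: ss_ZF_def set_add_def')
  note car = ss_Z_carrier[OF z] filt_carrier[OF w]
  have da: "cdiff A n a = cdiff A n w \<oplus>\<^bsub>cmod A (n + 1)\<^esub> cdiff A n z"
    using car by (simp add: a cmod.a_ac)
  have dz: "cdiff A n z \<in> filt A (p - int k - 1) (n + 1)"
    using z by (simp add: ss_Z_def algebra_simps)
  show ?thesis
  proof (cases k)
    case 0
    then show ?thesis using da dz filt_cdiff[OF w] by simp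
  next
    case (Suc j)
    have "cdiff A n w = cdiff A n a \<ominus>\<^bsub>cmod A (n + 1)\<^esub> cdiff A n z"
      using car by (simp add: da a_minus_def cmod.a_assoc cmod.r_neg)
    moreover have "cdiff A n z \<in> filt A (p - int k) (n + 1)"
      using dz by (auto intro: filt_le[rotated])
    ultimately have "cdiff A n w \<in> filt A (p - int k) (n + 1)"
      using assms(2) by (simp add: ss_Z_def a_minus_def)
    \<comment> \<open>Here p - k + j = p - 1; the index is kept in the shape that
      \<open>ss_B_SucI\<close> expects.\<close>
    then have "w \<in> ss_Z A j (p - int k + int j) (n + 1 - 1)"
      using w Suc by (simp add: ss_Z_def algebra_simps)
    moreover have "cdiff A n z \<in> ss_Z A j (p - int k - 1) (n + 1)"
      by (rule boundary_in_ss_Z[OF car(1) dz])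
    ultimately show ?thesis
      using ss_B_SucI[of w j "p - int k" "n + 1"] Suc da by simp
  qed
qed

end

text \<open>The summands \<open>b\<close> and \<open>c\<close> span a contractible complex with differential \<open>c \<mapsto> b\<close>, so
  as a complex this is \<open>A\<close> plus something contractible. For \<open>s < k\<close> an element \<open>y \<in> Z\<^sub>s\<close> lifts to
  \<open>(y, 0, y)\<close>, and for \<open>s > k\<close> it lifts to \<open>(y, 0, 0)\<close>, but for \<open>s = k\<close> neither works.\<close>

definition split_complex :: "('r, 'a) filt_complex \<Rightarrow> nat \<Rightarrow> ('r, 'a \<times> 'a \<times> 'a) filt_complex" where
  "split_complex A k =
     \<lparr>cmod = (\<lambda>n. direct_sum_module (cmod A n) (direct_sum_module (cmod A (n - 1)) (cmod A n))),
      cdiff = (\<lambda>n (x, b, c). (cdiff A n x, c, \<zero>\<^bsub>cmod A (n + 1)\<^esub>)),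
      filt = (\<lambda>p n. {(x, b, c). x \<in> filt A p n \<and> b \<in> ss_ZF A k (p + int k) (n - 1) \<and>
                c \<in> ss_ZF A k (p + int k) n \<and> x \<ominus>\<^bsub>cmod A n\<^esub> c \<in> ss_ZF A k p n})\<rparr>"

lemma split_complex_simps:
  "cmod (split_complex A k) n =
     direct_sum_module (cmod A n) (direct_sum_module (cmod A (n - 1)) (cmod A n))"
  "cdiff (split_complex A k) n (x, b, c) = (cdiff A n x, c, \<zero>\<^bsub>cmod A (n + 1)\<^esub>)"
  "(x, b, c) \<in> filt (split_complex A k) p n \<longleftrightarrow>
     x \<in> filt A p n \<and> b \<in> ss_ZF A k (p + int k) (n - 1) \<and> c \<in> ss_ZF A k (p + int k) n \<and>
     x \<ominus>\<^bsub>cmod A n\<^esub> c \<in> ss_ZF A k p n"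
  by (simp_all add: split_complex_def)

context filtered_complex
begin

text \<open>The filtration is stable under d(x, b, c) = (dx, c, 0) because the middle slot admits
  the same Q_(p+k) as the last one, and because dx, a boundary in F_p, lies in Q_p as the condition
  on the difference of the outer slots demands.\<close>

lemma split_complex_filtered: "filtered_complex R (split_complex A k)"
proof -
  have mod: "module R (cmod (split_complex A k) n)" for n
    by (simp add: split_complex_simps module_direct_sum cmod_module)
  show ?thesis
  proof (intro filtered_complex.intro filtered_complex_axioms.intro mod is_cring)
    show "cdiff (split_complex A k) n
        \<in> lin_maps R (cmod (split_complex A k) n) (cmod (split_complex A k) (n + 1))" for n
      by (rule lin_mapsI) (auto simp: split_complex_simps)
    show "submodule (filt (split_complex A k) p n) R (cmod (split_complex A k) n)" for p n
    proof (rule module.submodule_of_smult_closed[OF mod])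
      show "filt (split_complex A k) p n \<subseteq> carrier (cmod (split_complex A k) n)"
        by (auto simp: split_complex_simps dest: ss_ZF_carrier)
      show "\<zero>\<^bsub>cmod (split_complex A k) n\<^esub> \<in> filt (split_complex A k) p n"
        by (simp add: split_complex_simps ss_ZF_diff)
    next
      fix u v assume "u \<in> filt (split_complex A k) p n" "v \<in> filt (split_complex A k) p n"
      moreover obtain x b c x' b' c' where uv: "u = (x, b, c)" "v = (x', b', c')"
        by (metis prod_cases3)
      ultimately have u: "(x, b, c) \<in> filt (split_complex A k) p n"
        and v: "(x', b', c') \<in> filt (split_complex A k) p n" by simp_all
      have "x \<in> carrier (cmod A n)" "x' \<in> carrier (cmod A n)"
        "c \<in> carrier (cmod A n)" "c' \<in> carrier (cmod A n)"
        using u v by (auto simp: split_complex_simps dest: ss_ZF_carrier)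
      then have "(x \<oplus>\<^bsub>cmod A n\<^esub> x') \<ominus>\<^bsub>cmod A n\<^esub> (c \<oplus>\<^bsub>cmod A n\<^esub> c') =
          (x \<ominus>\<^bsub>cmod A n\<^esub> c) \<oplus>\<^bsub>cmod A n\<^esub> (x' \<ominus>\<^bsub>cmod A n\<^esub> c')"
        by (simp add: a_minus_def cmod.minus_add cmod.a_ac)
      then show "u \<oplus>\<^bsub>cmod (split_complex A k) n\<^esub> v \<in> filt (split_complex A k) p n"
        using u v by (simp add: uv split_complex_simps)
    next
      fix s u assume s: "s \<in> carrier R" and "u \<in> filt (split_complex A k) p n"
      moreover obtain x b c where uu: "u = (x, b, c)" by (metis prod_cases3)
      ultimately have u: "(x, b, c) \<in> filt (split_complex A k) p n" by simp
      have "x \<in> carrier (cmod A n)" "c \<in> carrier (cmod A n)"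
        using u by (auto simp: split_complex_simps dest: ss_ZF_carrier)
      then have "s \<odot>\<^bsub>cmod A n\<^esub> x \<ominus>\<^bsub>cmod A n\<^esub> s \<odot>\<^bsub>cmod A n\<^esub> c = s \<odot>\<^bsub>cmod A n\<^esub> (x \<ominus>\<^bsub>cmod A n\<^esub> c)"
        using s by (simp add: a_minus_def cmod.smult_r_distr cmod.smult_r_minus)
      then show "s \<odot>\<^bsub>cmod (split_complex A k) n\<^esub> u \<in> filt (split_complex A k) p n"
        using u s by (simp add: uu split_complex_simps)
    qed
    show "filt (split_complex A k) p n \<subseteq> filt (split_complex A k) (p + 1) n" for p n
      by (auto simp: split_complex_simps) (erule filt_le[rotated] ss_ZF_le[rotated], simp)+
    show "cdiff (split_complex A k) (n + 1) (cdiff (split_complex A k) n u)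
        = \<zero>\<^bsub>cmod (split_complex A k) (n + 1 + 1)\<^esub>"
      if "u \<in> carrier (cmod (split_complex A k) n)" for n u
      using that by (cases u) (auto simp: split_complex_simps cdiff_cdiff add.commute[of 1 n])
    show "cdiff (split_complex A k) n u \<in> filt (split_complex A k) p (n + 1)"
      if "u \<in> filt (split_complex A k) p n" for p n u
      using that boundary_in_ss_ZF[OF filt_carrier filt_cdiff]
      by (cases u) (auto simp: split_complex_simps filt_cdiff intro!: ss_ZF_diff)
  qed
qed

section \<open>The first projection is an acyclic fibration\<close>

lemma filt_hom_fst_split: "filt_hom R (split_complex A k) A (\<lambda>_. fst)"
  by (auto simp: filt_hom_def split_complex_simps intro!: lin_mapsI)

lemma split_complex_lift_Z:
  assumes "s \<noteq> k" "y \<in> ss_Z A s p n"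
  shows "\<exists>x \<in> ss_Z (split_complex A k) s p n. fst x = y"
proof (cases "s < k")
  case True
  have y: "y \<in> filt A p n" "cdiff A n y \<in> filt A (p - int s) (n + 1)" "y \<in> carrier (cmod A n)"
    using assms(2) by (auto simp: ss_Z_def)
  \<comment> \<open>The first membership puts (y, 0, y) into F_p; the second is what its
    differential (dy, y, 0) needs to lie in F_(p-s). Both indices exceed p because s < k.\<close>
  have "y \<in> ss_ZF A k (p + int k) n" "y \<in> ss_ZF A k (p - int s + int k) n"
    using filt_subset_ss_ZF[OF y(1)] True by simp_all
  then have "(y, \<zero>\<^bsub>cmod A (n - 1)\<^esub>, y) \<in> ss_Z (split_complex A k) s p n"
    using y boundary_in_ss_ZF[OF y(3,2)]
    by (simp add: ss_Z_def split_complex_simps a_minus_def cmod.r_neg)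
  then show ?thesis by (metis fst_conv)
next
  case False
  have y: "y \<in> filt A p n" "cdiff A n y \<in> filt A (p - int s) (n + 1)" "y \<in> carrier (cmod A n)"
    using assms(2) by (auto simp: ss_Z_def)
  \<comment> \<open>As s > k, Z_s^p \<subseteq> Z_(k+1)^p \<subseteq> Q_p, which is the condition on
    x - c when c = 0.\<close>
  have "y \<in> ss_ZF A k p n" using ss_Z_subset_ss_ZF[OF assms(2)] assms(1) False by simp
  then have "(y, \<zero>\<^bsub>cmod A (n - 1)\<^esub>, \<zero>\<^bsub>cmod A n\<^esub>) \<in> ss_Z (split_complex A k) s p n"
    using y boundary_in_ss_ZF[OF y(3,2)] by (simp add: ss_Z_def split_complex_simps ss_ZF_diff)
  then show ?thesis by (metis fst_conv)
qed

text \<open>For u = (x, b, c) take the lifts (\<open>y\<^sub>1\<close>, 0, b) and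
  (\<open>y\<^sub>2\<close>, 0, c): the differential of the first is (d \<open>y\<^sub>1\<close>, b,
  0), so it accounts for b, and the second accounts for c.\<close>

lemma split_complex_lift_B:
  assumes "k < r" and u: "u \<in> ss_Z (split_complex A k) (Suc r) p n"
    and y\<^sub>1: "y\<^sub>1 \<in> ss_Z A r (p + int r) (n - 1)" and y\<^sub>2: "y\<^sub>2 \<in> ss_Z A r (p - 1) n"
    and u_eq: "fst u = cdiff A (n - 1) y\<^sub>1 \<oplus>\<^bsub>cmod A n\<^esub> y\<^sub>2"
  shows "\<exists>u\<^sub>1 \<in> ss_Z (split_complex A k) r (p + int r) (n - 1).
         \<exists>u\<^sub>2 \<in> ss_Z (split_complex A k) r (p - 1) n.
           fst u\<^sub>1 = y\<^sub>1 \<and> fst u\<^sub>2 = y\<^sub>2 \<and>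
           u = cdiff (split_complex A k) (n - 1) u\<^sub>1 \<oplus>\<^bsub>cmod (split_complex A k) n\<^esub> u\<^sub>2"
proof -
  obtain x b c where xbc: "u = (x, b, c)" by (metis prod_cases3)
  \<comment> \<open>The bound on \<open>b\<close> comes from u in F_p. The bound on \<open>c\<close>
    comes from du = (dx, c, 0) in F_(p-r-1), where \<open>c\<close> sits in the middle slot.\<close>
  have b: "b \<in> ss_ZF A k (p + int k) (n - 1)" and c: "c \<in> ss_ZF A k (p - int (Suc r) + int k) n"
    and car: "b \<in> carrier (cmod A (n - 1))" "c \<in> carrier (cmod A n)"
    using u by (auto simp: xbc ss_Z_def split_complex_simps dest: ss_ZF_carrier)
  have y\<^sub>1': "y\<^sub>1 \<in> filt A (p + int r) (n - 1)" "cdiff A (n - 1) y\<^sub>1 \<in> filt A p n"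
      "y\<^sub>1 \<in> carrier (cmod A (n - 1))" "y\<^sub>1 \<in> ss_ZF A k (p + int r) (n - 1)"
      "cdiff A (n - 1) y\<^sub>1 \<in> ss_ZF A k p n"
    and y\<^sub>2': "y\<^sub>2 \<in> filt A (p - 1) n" "cdiff A n y\<^sub>2 \<in> filt A (p - 1 - int r) (n + 1)"
      "y\<^sub>2 \<in> carrier (cmod A n)" "y\<^sub>2 \<in> ss_ZF A k (p - 1) n"
      "cdiff A n y\<^sub>2 \<in> ss_ZF A k (p - 1 - int r) (n + 1)"
    using ss_Z_subset_ss_ZF[OF y\<^sub>1 assms(1)] ss_Z_subset_ss_ZF[OF y\<^sub>2 assms(1)] y\<^sub>1 y\<^sub>2
      boundary_in_ss_ZF[of y\<^sub>1 "n - 1" p k] boundary_in_ss_ZF[of y\<^sub>2 n "p - 1 - int r" k]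
    by (auto simp: ss_Z_def)
  \<comment> \<open>Since k < r, p + k is at most p + r and p - r - 1 + k is at most p - 1. This
    gives the memberships needed for the differences of \<open>y\<^sub>1\<close> and b, and of
    \<open>y\<^sub>2\<close> and c.\<close>
  have b': "b \<in> ss_ZF A k (p + int r) (n - 1)" "b \<in> ss_ZF A k (p + int r + int k) (n - 1)"
    using ss_ZF_le[OF _ b] assms(1) by simp_all
  have c': "c \<in> ss_ZF A k (p - 1) n" "c \<in> ss_ZF A k (p - 1 + int k) n"
    "c \<in> ss_ZF A k (p - 1 - int r + int k) n"
    using ss_ZF_le[OF _ c] assms(1) by simp_all
  let ?u\<^sub>1 = "(y\<^sub>1, \<zero>\<^bsub>cmod A (n - 1 - 1)\<^esub>, b)" and ?u\<^sub>2 = "(y\<^sub>2, \<zero>\<^bsub>cmod A (n - 1)\<^esub>, c)"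
  have "?u\<^sub>1 \<in> ss_Z (split_complex A k) r (p + int r) (n - 1)"
    using b b' y\<^sub>1' by (simp add: ss_Z_def split_complex_simps ss_ZF_diff)
  moreover have "?u\<^sub>2 \<in> ss_Z (split_complex A k) r (p - 1) n"
    using c' y\<^sub>2' by (simp add: ss_Z_def split_complex_simps ss_ZF_diff)
  moreover have "u = cdiff (split_complex A k) (n - 1) ?u\<^sub>1 \<oplus>\<^bsub>cmod (split_complex A k) n\<^esub> ?u\<^sub>2"
    using u_eq car by (simp add: xbc split_complex_simps)
  ultimately show ?thesis by (metis fst_conv)
qed

text \<open>The assumption k < r serves the lifts against \<open>phi\<close>; k \<notin> S ensures s
  \<noteq> k in the lifts of cycles.\<close>

lemma acyclic_fibration_split:
  assumes "k < r" "k \<notin> S"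
  shows "acyclic_fibration R r S (split_complex A k) A (\<lambda>_. fst)"
  unfolding acyclic_fibration_def
proof (intro conjI allI ballI filt_hom_fst_split)
  note intros = split_complex_filtered filtered_complex_axioms filt_hom_fst_split
  fix p n
  show "has_lifting R (cycle_complex R (r + 1) p n) (boundary_complex R (r + 1) p n) (phi R n)
      (split_complex A k) A (\<lambda>_. fst)"
    by (intro has_lifting_boundaryI intros split_complex_lift_B[OF assms(1)])
  show "has_lifting R zero_complex (cycle_complex R s p n) (initial_map (cycle_complex R s p n))
      (split_complex A k) A (\<lambda>_. fst)" if "s \<in> S" for s
    using that assms(2) by (intro has_lifting_cycleI intros split_complex_lift_Z) auto
qed

end

text \<open>This embeds the elements of \<open>split_complex\<close> into the universe of
  \<open>cofibrant\<close>: entries 0, 1 and 2 of the sequence recover the triple, and a fixed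
  \<open>y\<close> fills the ring component.\<close>

lemma inj_triple_to_seq:
  "inj (\<lambda>(x, b, c) i. (if i = (0 :: nat) then x else if i = 1 then b else c, y))"
  (is "inj ?e")
proof (rule injI)
  fix s t assume "?e s = ?e t"
  from fun_cong[OF this, of 0] fun_cong[OF this, of 1] fun_cong[OF this, of 2]
  show "s = t" by (cases s; cases t) simp
qed

section \<open>The section of the projection and the vanishing of d_k\<close>

lemma cofibrant_ss_Z_subset:
  fixes A :: "('r, 'a) filt_complex"
  assumes A: "filtered_complex R A" and cof: "cofibrant R r S A" and k: "k < r" "k \<notin> S"
    and a: "a \<in> ss_Z A k p n"
  shows "a \<in> ss_ZF A k p n"
proof -
  interpret filtered_complex R A by fact
  interpret X: filtered_complex R "split_complex A k" by (rule split_complex_filtered)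
  \<comment> \<open>Elements of A itself enter the universe as constant sequences with an arbitrary
    ring component.\<close>
  have "inj (\<lambda>(x :: 'a) (i :: nat). (x, undefined :: 'r))" by (auto intro!: injI dest: fun_cong)
  then have lift: "has_lifting R zero_complex A (initial_map A) (split_complex A k) A (\<lambda>_. fst)"
    by (rule cofibrant_lifting[OF cof A split_complex_filtered A acyclic_fibration_split[OF k]
        inj_triple_to_seq])
  \<comment> \<open>With the identity of A at the bottom of the square, the lift \<open>h\<close> is
    a section of the projection.\<close>
  have "filt_hom R A A (\<lambda>_ x. x)"
    by (auto simp: filt_hom_def intro!: lin_mapsI)
  then obtain h where h: "filt_hom R A (split_complex A k) h"
    and fst_h: "\<And>n x. x \<in> carrier (cmod A n) \<Longrightarrow> fst (h n x) = x"
    by (rule has_liftingE[OF lift X.filt_hom_initial_map])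
      (simp_all add: initial_map_def split_complex_simps)
  have car: "a \<in> carrier (cmod A n)" and Z: "a \<in> filt A p n" "cdiff A n a \<in> filt A (p - int k) (n + 1)"
    using a by (auto simp: ss_Z_def)
  obtain b c where ha: "h n a = (a, b, c)"
    using fst_h[OF car] by (metis prod.collapse)
  have "(a, b, c) \<in> filt (split_complex A k) p n"
    using filt_homD(6)[OF h Z(1)] ha by simp
  then have ac: "a \<ominus>\<^bsub>cmod A n\<^esub> c \<in> ss_ZF A k p n" by (simp add: split_complex_simps)
  \<comment> \<open>As \<open>h\<close> commutes with the differentials, the last component
    \<open>c\<close> of h(a) becomes the middle one of h(da). The middle slot of F_(p-k) asks for
    membership in Q_(p-k+k) = Q_p.\<close>
  have "h (n + 1) (cdiff A n a) = (cdiff A n a, c, \<zero>\<^bsub>cmod A (n + 1)\<^esub>)"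
    using filt_homD(5)[OF h car] ha by (simp add: split_complex_simps)
  then have "c \<in> ss_ZF A k p n"
    using filt_homD(6)[OF h Z(2)] by (simp add: split_complex_simps)
  moreover have "a = (a \<ominus>\<^bsub>cmod A n\<^esub> c) \<oplus>\<^bsub>cmod A n\<^esub> c"
    using car ss_ZF_carrier[OF calculation] by (simp add: a_minus_def cmod.a_assoc cmod.l_neg)
  ultimately show ?thesis using ac ss_ZF_simps(2) by metis
qed

theorem corollary4p1p11:
  fixes R :: "('r, 'm) ring_scheme"
    and A :: "('r, 'a) filt_complex"
    and r k :: nat
    and S :: "nat set"
  assumes "cring R"
    and "S \<subseteq> {0..r}" and "r \<in> S"
    and "filtered_complex R A"
    and "cofibrant R r S A"
    and "k < r" and "k \<notin> S"
  shows "\<forall>p n. \<forall>x \<in> carrier (ss_page A k p n).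
           ss_d A k p n x = \<zero>\<^bsub>ss_page A k (p - int k) (n + 1)\<^esub>"
proof -
  interpret filtered_complex R A by fact
  show ?thesis
    using ss_d_eq_zero cdiff_in_ss_B cofibrant_ss_Z_subset[OF assms(4-7)] by blast
qed

end
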